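(* Let $\mathbb{E}$ be a finitely complete category. Let $T$ be a preorder (resp. an equivalence relation) on $X$, let $S$ be a preorder (resp. an equivalence relation) on $Y$, and let $(f,\bar f):T\to S$ be a map in $PrO\,\mathbb{E}$ (resp. in $Equ\,\mathbb{E}$) above a split epimorphism $f:X\to Y$ (with a splitting $s:Y\to X$) in $\mathbb{E}$. Then $(f,\bar f)$ is cocartesian with respect to $(\;)_0$ in $PrO\,\mathbb{E}$ (resp. in $Equ\,\mathbb{E}$) if and only if $f^{-1}(S)=R[f]\vee T$ in $PrO\,\mathbb{E}$ (resp. in $Equ\,\mathbb{E}$), i.e. $f^{-1}(S)$ is the supremum of $R[f]$ and $T$ among the preorders (resp. the equivalence relations) on $X$. When, in addition, the category $\mathbb{E}$ is regular, the same equivalence holds for any regular epimorphism $f:X\to Y$. In this case the cocartesian image is $f_!(T)=f(R[f]\vee T)$.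
   Context: A relation on $X$ is (a class up to isomorphism of) a subobject $R\rightarrowtail X\times X$; relations are ordered by inclusion. $\Delta_X$ is the diagonal. A relation $R$ is reflexive if $\Delta_X\subset R$, symmetric if $R^{op}\subset R$; transitivity is meant internally (equivalently, $\mathrm{Hom}(A,R)$ is a transitive relation on $\mathrm{Hom}(A,X)$ for every object $A$; in a regular category, $R\circ R\subset R$). A preorder is a reflexive transitive relation; an equivalence relation is a symmetric preorder. For $f:X\to Y$ and a relation $S$ on $Y$, the inverse image $f^{-1}(S)$ is the pullback of $S\rightarrowtail Y\times Y$ along $f\times f$; $R[f]=f^{-1}(\Delta_Y)$ is the kernel equivalence relation of $f$. $Ref\,\mathbb{E}$ is the category whose objects are pairs (object $X$, reflexive relation $R$ on $X$) and in which a morphism $R\to S$ above $f:X\to Y$ exists (and is unique) iff $R\subset f^{-1}(S)$; $(\;)_0$ is the forgetful functor to $\mathbb{E}$ sending $R$ to its ground object $X$. $PrO\,\mathbb{E}$ and $Equ\,\mathbb{E}$ are its full subcategories of preorders and of equivalence relations, with the restrictions of $(\;)_0$. Given a functor $U:\mathbb{C}\to\mathbb{D}$, a map $f:X\to Z$ of $\mathbb{C}$ is cocartesian with respect to $U$ when, for every map $\phi:X\to W$ with $U(\phi)=U(f)$, there is a unique $\psi:Z\to W$ with $\psi f=\phi$ and $U(\psi)=1_{U(Z)}$. The codomain of a cocartesian map above $f$ with domain $T$ is denoted $f_!(T)$ and called the cocartesian image of $T$. A regular category is a finitely complete category in which every map factors as a regular epimorphism followed by a monomorphism, regular epimorphisms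 being stable under pullback. When $\mathbb{E}$ is regular and $f$ is a regular epimorphism, the direct image $f(R)$ of a relation $R$ on $X$ is the image of $R\rightarrowtail X\times X\xrightarrow{f\times f}Y\times Y$. *)

theory Defs
  imports "HOL-Algebra.Order"
begin

section \<open>Categories, functors and limits\<close>

record ('o, 'a) cat =
  Obj :: "'o set"
  Arr :: "'a set"
  Dom :: "'a \<Rightarrow> 'o"
  Cod :: "'a \<Rightarrow> 'o"
  Ide :: "'o \<Rightarrow> 'a"
  Cmp :: "'a \<Rightarrow> 'a \<Rightarrow> 'a"  (infixl "\<cdot>\<index>" 70)

definition hom :: "('o, 'a) cat \<Rightarrow> 'o \<Rightarrow> 'o \<Rightarrow> 'a set" where
  "hom C A B = {f \<in> Arr C. Dom C f = A \<and> Cod C f = B}"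

locale category =
  fixes C :: "('o, 'a) cat" (structure)
  assumes dom_obj: "f \<in> Arr C \<Longrightarrow> Dom C f \<in> Obj C"
    and cod_obj: "f \<in> Arr C \<Longrightarrow> Cod C f \<in> Obj C"
    and ide_hom: "A \<in> Obj C \<Longrightarrow> Ide C A \<in> hom C A A"
    and cmp_hom: "\<lbrakk>f \<in> hom C A B; g \<in> hom C B D\<rbrakk> \<Longrightarrow> g \<cdot> f \<in> hom C A D"
    and cmp_ide: "f \<in> Arr C \<Longrightarrow> f \<cdot> Ide C (Dom C f) = f"
    and ide_cmp: "f \<in> Arr C \<Longrightarrow> Ide C (Cod C f) \<cdot> f = f"
    and cmp_assoc: "\<lbrakk>f \<in> Arr C; g \<in> Arr C; h \<in> Arr C; Cod C f = Dom C g; Cod C g = Dom C h\<rbrakk>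
      \<Longrightarrow> (h \<cdot> g) \<cdot> f = h \<cdot> (g \<cdot> f)"

record ('o, 'a, 'p, 'b) cat_functor =
  on_obj :: "'o \<Rightarrow> 'p"
  on_arr :: "'a \<Rightarrow> 'b"

definition is_functor :: "('o, 'a) cat \<Rightarrow> ('p, 'b) cat \<Rightarrow> ('o, 'a, 'p, 'b) cat_functor \<Rightarrow> bool" where
  "is_functor C D U \<longleftrightarrow>
     (\<forall>A \<in> Obj C. on_obj U A \<in> Obj D \<and> on_arr U (Ide C A) = Ide D (on_obj U A)) \<and>
     (\<forall>f \<in> Arr C. on_arr U f \<in> hom D (on_obj U (Dom C f)) (on_obj U (Cod C f))) \<and>
     (\<forall>f \<in> Arr C. \<forall>g \<in> Arr C. Cod C f = Dom C g \<longrightarrow>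
        on_arr U (g \<cdot>\<^bsub>C\<^esub> f) = on_arr U g \<cdot>\<^bsub>D\<^esub> on_arr U f)"

definition is_cone ::
  "('p, 'b) cat \<Rightarrow> ('o, 'a) cat \<Rightarrow> ('p, 'b, 'o, 'a) cat_functor \<Rightarrow> 'o \<Rightarrow> ('p \<Rightarrow> 'a) \<Rightarrow> bool" where
  "is_cone J C D L p \<longleftrightarrow> L \<in> Obj C \<and>
     (\<forall>j \<in> Obj J. p j \<in> hom C L (on_obj D j)) \<and>
     (\<forall>u \<in> Arr J. on_arr D u \<cdot>\<^bsub>C\<^esub> p (Dom J u) = p (Cod J u))"

definition is_limit ::
  "('p, 'b) cat \<Rightarrow> ('o, 'a) cat \<Rightarrow> ('p, 'b, 'o, 'a) cat_functor \<Rightarrow> 'o \<Rightarrow> ('p \<Rightarrow> 'a) \<Rightarrow> bool" where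
  "is_limit J C D L p \<longleftrightarrow> is_cone J C D L p \<and>
     (\<forall>M q. is_cone J C D M q \<longrightarrow>
        (\<exists>!h. h \<in> hom C M L \<and> (\<forall>j \<in> Obj J. p j \<cdot>\<^bsub>C\<^esub> h = q j)))"

text \<open>Every finite category is isomorphic to one whose objects and arrows are natural numbers,
  so index categories of this type account for all finite limits.\<close>

locale finitely_complete_category = category +
  assumes finite_limits:
    "\<And>(J :: (nat, nat) cat) D. \<lbrakk>category J; finite (Obj J); finite (Arr J); is_functor J C D\<rbrakk>
       \<Longrightarrow> \<exists>L p. is_limit J C D L p"

definition monic :: "('o, 'a) cat \<Rightarrow> 'a \<Rightarrow> bool" where
  "monic C m \<longleftrightarrow> m \<in> Arr C \<and>
     (\<forall>A. \<forall>g \<in> hom C A (Dom C m). \<forall>h \<in> hom C A (Dom C m). m \<cdot>\<^bsub>C\<^esub> g = m \<cdot>\<^bsub>C\<^esub> h \<longrightarrow> g = h)"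

definition is_iso :: "('o, 'a) cat \<Rightarrow> 'a \<Rightarrow> bool" where
  "is_iso C i \<longleftrightarrow> i \<in> Arr C \<and>
     (\<exists>j \<in> hom C (Cod C i) (Dom C i).
        j \<cdot>\<^bsub>C\<^esub> i = Ide C (Dom C i) \<and> i \<cdot>\<^bsub>C\<^esub> j = Ide C (Cod C i))"

definition is_coequalizer :: "('o, 'a) cat \<Rightarrow> 'a \<Rightarrow> 'a \<Rightarrow> 'a \<Rightarrow> bool" where
  "is_coequalizer C a b e \<longleftrightarrow> e \<in> Arr C \<and>
     (\<exists>K. a \<in> hom C K (Dom C e) \<and> b \<in> hom C K (Dom C e)) \<and> e \<cdot>\<^bsub>C\<^esub> a = e \<cdot>\<^bsub>C\<^esub> b \<and>
     (\<forall>Z. \<forall>g \<in> hom C (Dom C e) Z. g \<cdot>\<^bsub>C\<^esub> a = g \<cdot>\<^bsub>C\<^esub> b \<longrightarrow>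
        (\<exists>!h. h \<in> hom C (Cod C e) Z \<and> h \<cdot>\<^bsub>C\<^esub> e = g))"

definition regular_epi :: "('o, 'a) cat \<Rightarrow> 'a \<Rightarrow> bool" where
  "regular_epi C e \<longleftrightarrow> (\<exists>a b. is_coequalizer C a b e)"

text \<open>The square has sides \<open>f \<cdot> p = g \<cdot> q\<close>; thus \<open>q\<close> is the pullback of \<open>f\<close> along \<open>g\<close>,
  and \<open>p\<close> is the pullback of \<open>g\<close> along \<open>f\<close>.\<close>

definition is_pullback :: "('o, 'a) cat \<Rightarrow> 'a \<Rightarrow> 'a \<Rightarrow> 'a \<Rightarrow> 'a \<Rightarrow> bool" where
  "is_pullback C f g p q \<longleftrightarrow> f \<in> Arr C \<and> g \<in> Arr C \<and> Cod C f = Cod C g \<and>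
     (\<exists>P. p \<in> hom C P (Dom C f) \<and> q \<in> hom C P (Dom C g)) \<and> f \<cdot>\<^bsub>C\<^esub> p = g \<cdot>\<^bsub>C\<^esub> q \<and>
     (\<forall>A. \<forall>u \<in> hom C A (Dom C f). \<forall>v \<in> hom C A (Dom C g). f \<cdot>\<^bsub>C\<^esub> u = g \<cdot>\<^bsub>C\<^esub> v \<longrightarrow>
        (\<exists>!h. h \<in> hom C A (Dom C p) \<and> p \<cdot>\<^bsub>C\<^esub> h = u \<and> q \<cdot>\<^bsub>C\<^esub> h = v))"

locale regular_category = finitely_complete_category +
  assumes factorization:
      "f \<in> Arr C \<Longrightarrow> \<exists>e m. regular_epi C e \<and> monic C m \<and> Cod C e = Dom C m \<and> m \<cdot> e = f"
    and regular_epi_stable: "\<lbrakk>is_pullback C f g p q; regular_epi C f\<rbrakk> \<Longrightarrow> regular_epi C q"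


section \<open>Cocartesian maps\<close>

definition cocartesian ::
  "('o, 'a) cat \<Rightarrow> ('p, 'b) cat \<Rightarrow> ('o, 'a, 'p, 'b) cat_functor \<Rightarrow> 'a \<Rightarrow> bool" where
  "cocartesian C D U f \<longleftrightarrow> f \<in> Arr C \<and>
     (\<forall>W. \<forall>\<phi> \<in> hom C (Dom C f) W. on_arr U \<phi> = on_arr U f \<longrightarrow>
        (\<exists>!\<psi>. \<psi> \<in> hom C (Cod C f) W \<and> \<psi> \<cdot>\<^bsub>C\<^esub> f = \<phi> \<and>
              on_arr U \<psi> = Ide D (on_obj U (Cod C f))))"

definition cocartesian_image ::
  "('o, 'a) cat \<Rightarrow> ('p, 'b) cat \<Rightarrow> ('o, 'a, 'p, 'b) cat_functor \<Rightarrow> 'b \<Rightarrow> 'o \<Rightarrow> 'o \<Rightarrow> bool" where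
  "cocartesian_image C D U f A Z \<longleftrightarrow>
     (\<exists>g \<in> hom C A Z. on_arr U g = f \<and> cocartesian C D U g)"


section \<open>Binary products\<close>

definition is_product :: "('o, 'a) cat \<Rightarrow> 'o \<Rightarrow> 'o \<Rightarrow> 'o \<times> 'a \<times> 'a \<Rightarrow> bool" where
  "is_product C X Y = (\<lambda>(P, p, q). P \<in> Obj C \<and> p \<in> hom C P X \<and> q \<in> hom C P Y \<and>
     (\<forall>A. \<forall>u \<in> hom C A X. \<forall>v \<in> hom C A Y.
        (\<exists>!h. h \<in> hom C A P \<and> p \<cdot>\<^bsub>C\<^esub> h = u \<and> q \<cdot>\<^bsub>C\<^esub> h = v)))"

text \<open>A fixed choice of products, which exist in a finitely complete category.\<close>

definition chosen_product :: "('o, 'a) cat \<Rightarrow> 'o \<Rightarrow> 'o \<Rightarrow> 'o \<times> 'a \<times> 'a" where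
  "chosen_product C X Y = (SOME t. is_product C X Y t)"

definition Prod :: "('o, 'a) cat \<Rightarrow> 'o \<Rightarrow> 'o \<Rightarrow> 'o" where
  "Prod C X Y = fst (chosen_product C X Y)"

definition pr0 :: "('o, 'a) cat \<Rightarrow> 'o \<Rightarrow> 'o \<Rightarrow> 'a" where
  "pr0 C X Y = fst (snd (chosen_product C X Y))"

definition pr1 :: "('o, 'a) cat \<Rightarrow> 'o \<Rightarrow> 'o \<Rightarrow> 'a" where
  "pr1 C X Y = snd (snd (chosen_product C X Y))"

definition pairing :: "('o, 'a) cat \<Rightarrow> 'a \<Rightarrow> 'a \<Rightarrow> 'a" where
  "pairing C u v = (THE h. h \<in> hom C (Dom C u) (Prod C (Cod C u) (Cod C v)) \<and>
     pr0 C (Cod C u) (Cod C v) \<cdot>\<^bsub>C\<^esub> h = u \<and> pr1 C (Cod C u) (Cod C v) \<cdot>\<^bsub>C\<^esub> h = v)"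

definition square_map :: "('o, 'a) cat \<Rightarrow> 'a \<Rightarrow> 'a" where
  "square_map C f =
     pairing C (f \<cdot>\<^bsub>C\<^esub> pr0 C (Dom C f) (Dom C f)) (f \<cdot>\<^bsub>C\<^esub> pr1 C (Dom C f) (Dom C f))"


section \<open>Subobjects and internal relations\<close>

definition monos_into :: "('o, 'a) cat \<Rightarrow> 'o \<Rightarrow> 'a set" where
  "monos_into C A = {m. monic C m \<and> Cod C m = A}"

definition mono_iso :: "('o, 'a) cat \<Rightarrow> 'o \<Rightarrow> ('a \<times> 'a) set" where
  "mono_iso C A = {(m, n). m \<in> monos_into C A \<and> n \<in> monos_into C A \<and>
     (\<exists>i \<in> hom C (Dom C m) (Dom C n). is_iso C i \<and> n \<cdot>\<^bsub>C\<^esub> i = m)}"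

definition subobjects :: "('o, 'a) cat \<Rightarrow> 'o \<Rightarrow> 'a set set" where
  "subobjects C A = monos_into C A // mono_iso C A"

definition sub_class :: "('o, 'a) cat \<Rightarrow> 'a \<Rightarrow> 'a set" where
  "sub_class C m = mono_iso C (Cod C m) `` {m}"

text \<open>On isomorphism classes, inclusion does not depend on the representatives.\<close>

definition sub_le :: "('o, 'a) cat \<Rightarrow> 'a set \<Rightarrow> 'a set \<Rightarrow> bool" where
  "sub_le C R S \<longleftrightarrow> (\<exists>m \<in> R. \<exists>n \<in> S. \<exists>k \<in> hom C (Dom C m) (Dom C n). n \<cdot>\<^bsub>C\<^esub> k = m)"

definition relations :: "('o, 'a) cat \<Rightarrow> 'o \<Rightarrow> 'a set set" where
  "relations C X = subobjects C (Prod C X X)"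

definition diagonal_rel :: "('o, 'a) cat \<Rightarrow> 'o \<Rightarrow> 'a set" where
  "diagonal_rel C X = sub_class C (pairing C (Ide C X) (Ide C X))"

definition opposite_rel :: "('o, 'a) cat \<Rightarrow> 'o \<Rightarrow> 'a set \<Rightarrow> 'a set" where
  "opposite_rel C X R = (\<lambda>m. pairing C (pr1 C X X \<cdot>\<^bsub>C\<^esub> m) (pr0 C X X \<cdot>\<^bsub>C\<^esub> m)) ` R"

text \<open>The relation \<open>Hom(A,R)\<close> induced by \<open>R\<close> on the set \<open>Hom(A,X)\<close>.\<close>

definition hom_rel :: "('o, 'a) cat \<Rightarrow> 'o \<Rightarrow> 'o \<Rightarrow> 'a set \<Rightarrow> ('a \<times> 'a) set" where
  "hom_rel C A X R = {(a, b). a \<in> hom C A X \<and> b \<in> hom C A X \<and>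
     (\<exists>m \<in> R. \<exists>k \<in> hom C A (Dom C m). m \<cdot>\<^bsub>C\<^esub> k = pairing C a b)}"

definition reflexive_rel :: "('o, 'a) cat \<Rightarrow> 'o \<Rightarrow> 'a set \<Rightarrow> bool" where
  "reflexive_rel C X R \<longleftrightarrow> R \<in> relations C X \<and> sub_le C (diagonal_rel C X) R"

definition symmetric_rel :: "('o, 'a) cat \<Rightarrow> 'o \<Rightarrow> 'a set \<Rightarrow> bool" where
  "symmetric_rel C X R \<longleftrightarrow> R \<in> relations C X \<and> sub_le C (opposite_rel C X R) R"

definition transitive_rel :: "('o, 'a) cat \<Rightarrow> 'o \<Rightarrow> 'a set \<Rightarrow> bool" where
  "transitive_rel C X R \<longleftrightarrow> R \<in> relations C X \<and> (\<forall>A \<in> Obj C. trans (hom_rel C A X R))"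

definition preorder_rel :: "('o, 'a) cat \<Rightarrow> 'o \<Rightarrow> 'a set \<Rightarrow> bool" where
  "preorder_rel C X R \<longleftrightarrow> reflexive_rel C X R \<and> transitive_rel C X R"

definition equivalence_rel :: "('o, 'a) cat \<Rightarrow> 'o \<Rightarrow> 'a set \<Rightarrow> bool" where
  "equivalence_rel C X R \<longleftrightarrow> preorder_rel C X R \<and> symmetric_rel C X R"

text \<open>The next two sets are themselves isomorphism classes of monomorphisms: the pullbacks of
  representatives of \<open>S\<close> along \<open>f \<times> f\<close>, and the monomorphic parts of the (regular epi, mono)
  factorizations of the composites of representatives of \<open>R\<close> with \<open>f \<times> f\<close>.\<close>

definition inverse_image :: "('o, 'a) cat \<Rightarrow> 'a \<Rightarrow> 'a set \<Rightarrow> 'a set" where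
  "inverse_image C f S = {m. \<exists>n \<in> S. \<exists>k. is_pullback C (square_map C f) n m k}"

definition direct_image :: "('o, 'a) cat \<Rightarrow> 'a \<Rightarrow> 'a set \<Rightarrow> 'a set" where
  "direct_image C f R = {m. monic C m \<and>
     (\<exists>r \<in> R. \<exists>e. regular_epi C e \<and> Cod C e = Dom C m \<and> m \<cdot>\<^bsub>C\<^esub> e = square_map C f \<cdot>\<^bsub>C\<^esub> r)}"

definition kernel_rel :: "('o, 'a) cat \<Rightarrow> 'a \<Rightarrow> 'a set" where
  "kernel_rel C f = inverse_image C f (diagonal_rel C (Cod C f))"


section \<open>The categories of reflexive relations, preorders and equivalence relations\<close>

text \<open>A morphism above \<open>f\<close> is determined by \<open>f\<close> together with its domain and its codomain.\<close>

type_synonym ('o, 'a) rel_obj = "'o \<times> 'a set"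
type_synonym ('o, 'a) rel_arr = "('o, 'a) rel_obj \<times> 'a \<times> ('o, 'a) rel_obj"

definition Ref :: "('o, 'a) cat \<Rightarrow> (('o, 'a) rel_obj, ('o, 'a) rel_arr) cat" where
  "Ref E = \<lparr>
     Obj = {(X, R). X \<in> Obj E \<and> reflexive_rel E X R},
     Arr = {((X, R), f, (Y, S)) | X R f Y S.
              X \<in> Obj E \<and> reflexive_rel E X R \<and> Y \<in> Obj E \<and> reflexive_rel E Y S \<and>
              f \<in> hom E X Y \<and> sub_le E R (inverse_image E f S)},
     Dom = (\<lambda>(A, f, B). A),
     Cod = (\<lambda>(A, f, B). B),
     Ide = (\<lambda>A. (A, Ide E (fst A), A)),
     Cmp = (\<lambda>(B', g, D) (A, f, B). (A, g \<cdot>\<^bsub>E\<^esub> f, D))\<rparr>"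

definition full_subcategory :: "('o, 'a) cat \<Rightarrow> ('o \<Rightarrow> bool) \<Rightarrow> ('o, 'a) cat" where
  "full_subcategory C P = C\<lparr>Obj := {A \<in> Obj C. P A},
     Arr := {f \<in> Arr C. P (Dom C f) \<and> P (Cod C f)}\<rparr>"

definition PrO :: "('o, 'a) cat \<Rightarrow> (('o, 'a) rel_obj, ('o, 'a) rel_arr) cat" where
  "PrO E = full_subcategory (Ref E) (\<lambda>(X, R). preorder_rel E X R)"

definition Equ :: "('o, 'a) cat \<Rightarrow> (('o, 'a) rel_obj, ('o, 'a) rel_arr) cat" where
  "Equ E = full_subcategory (Ref E) (\<lambda>(X, R). equivalence_rel E X R)"

definition ground :: "(('o, 'a) rel_obj, ('o, 'a) rel_arr, 'o, 'a) cat_functor" where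
  "ground = \<lparr>on_obj = fst, on_arr = (\<lambda>(A, f, B). f)\<rparr>"

text \<open>For \<open>K\<close> one of the categories above: the relations on \<open>X\<close> which belong to \<open>K\<close>, ordered by
  inclusion. Suprema in it are the suprema among the preorders (resp. equivalence relations)
  on \<open>X\<close>.\<close>

definition fibre_order ::
  "('o, 'a) cat \<Rightarrow> (('o, 'a) rel_obj, ('o, 'a) rel_arr) cat \<Rightarrow> 'o \<Rightarrow> 'a set gorder" where
  "fibre_order E K X = \<lparr>carrier = {R. (X, R) \<in> Obj K}, eq = (=), le = sub_le E\<rparr>"

definition is_join :: "('b, 'm) gorder_scheme \<Rightarrow> 'b \<Rightarrow> 'b \<Rightarrow> 'b \<Rightarrow> bool" where
  "is_join L V A B \<longleftrightarrow> A \<in> carrier L \<and> B \<in> carrier L \<and> least L V (Upper L {A, B})"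

end

theory Submission
  imports Defs
begin

text \<open>
A relation is determined by the relations that it induces on generalized elements, and inclusion can
be tested there (\<open>sub_le_hom_rel\<close>). In these terms \<open>(a, b)\<close> belongs to the inverse image of \<open>S\<close>
when \<open>(f \<cdot> a, f \<cdot> b)\<close> belongs to \<open>S\<close>, and preorders and equivalence relations become preorders and
equivalence relations of sets, natural in the domain of the elements.

Since arrows above a given map are unique, \<open>f : T \<rightarrow> S\<close> is cocartesian precisely when \<open>S\<close> is the
least relation \<open>W\<close> of its kind on \<open>Y\<close> with \<open>T\<close> included in the inverse image of \<open>W\<close>
(\<open>cocartesian_iff_least\<close>). Taking inverse images along \<open>f\<close> turns this into a statement on \<open>X\<close>.
Suppose that inverse image along \<open>f\<close> reflects inclusion and that its values on the relations of the
given kind on \<open>Y\<close> are all those on \<open>X\<close> that contain the kernel relation of \<open>f\<close>. It is then an order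
isomorphism onto the latter, and the least \<open>W\<close> corresponds to the least relation containing both the
kernel relation and \<open>T\<close> (\<open>cocartesian_iff_join\<close>).

Both suppositions hold in the two cases at hand. If \<open>V\<close> contains the kernel relation of \<open>f\<close>, then
elements of \<open>X\<close> with the same image under \<open>f\<close> are interchangeable in \<open>V\<close>. When \<open>s\<close> splits \<open>f\<close>,
every \<open>x\<close> may thus be replaced by \<open>s \<cdot> f \<cdot> x\<close>, so \<open>V\<close> is the inverse image of the inverse image
of \<open>V\<close> along \<open>s\<close> (\<open>inverse_image_descend_split\<close>). When \<open>f\<close> is a regular epimorphism in a regular
category, elements of \<open>Y\<close> lift to \<open>X\<close> after restriction along a regular epimorphism, and membership
in a relation descends along regular epimorphisms. The argument of sets then shows that the direct
image of \<open>V\<close> is again a preorder (or equivalence relation) and has \<open>V\<close> as its inverse image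
(\<open>internal_order_direct_image\<close>, \<open>inverse_direct_image\<close>). For \<open>V\<close> the join of the kernel relation and
\<open>T\<close>, this identifies the cocartesian image with the direct image of \<open>V\<close>.
\<close>

section \<open>Finite limits\<close>

context category
begin

lemma homD:
  assumes "f \<in> hom C A B"
  shows "f \<in> Arr C" "Dom C f = A" "Cod C f = B" "A \<in> Obj C" "B \<in> Obj C"
  using assms dom_obj cod_obj by (auto simp: hom_def)

lemma homI: "f \<in> Arr C \<Longrightarrow> f \<in> hom C (Dom C f) (Cod C f)"
  by (simp add: hom_def)

lemma hom_assoc:
  assumes "f \<in> hom C A B" "g \<in> hom C B D" "h \<in> hom C D F"
  shows "(h \<cdot> g) \<cdot> f = h \<cdot> (g \<cdot> f)"
  using assms cmp_assoc by (auto simp: hom_def)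

lemma cmp_ide_hom: "f \<in> hom C A B \<Longrightarrow> f \<cdot> Ide C A = f"
  using cmp_ide by (auto simp: hom_def)

lemma ide_cmp_hom: "f \<in> hom C A B \<Longrightarrow> Ide C B \<cdot> f = f"
  using ide_cmp by (auto simp: hom_def)

end

context finitely_complete_category
begin

lemma product_exists:
  assumes X: "X \<in> Obj C" and Y: "Y \<in> Obj C"
  shows "\<exists>t. is_product C X Y t"
proof -
  define J :: "(nat, nat) cat" where
    "J = \<lparr>Obj = {0, 1}, Arr = {0, 1}, Dom = id, Cod = id, Ide = id, Cmp = (\<lambda>g f. f)\<rparr>"
  define x where "x = (\<lambda>j::nat. if j = 0 then X else Y)"
  define D where "D = \<lparr>on_obj = x, on_arr = (\<lambda>j. Ide C (x j))\<rparr>"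
  have x: "x j \<in> Obj C" for j using X Y by (simp add: x_def)
  have J: "category J" by unfold_locales (auto simp: J_def hom_def)
  have F: "is_functor J C D"
    using ide_hom[OF x] cmp_ide_hom[OF ide_hom[OF x]] x
    by (auto simp: is_functor_def J_def D_def)
  have cone: "is_cone J C D L p \<longleftrightarrow> p 0 \<in> hom C L X \<and> p 1 \<in> hom C L Y" for L p
    using homD(4)[of "p 0" L X] ide_cmp_hom[of "p 0" L X] ide_cmp_hom[of "p 1" L Y]
    by (auto simp: is_cone_def J_def D_def x_def)
  obtain L p where lim: "is_limit J C D L p"
    using finite_limits[OF J _ _ F] by (auto simp: J_def)
  have "is_product C X Y (L, p 0, p 1)"
    unfolding is_product_def prod.case
  proof (intro conjI allI ballI)
    show p: "p 0 \<in> hom C L X" "p 1 \<in> hom C L Y"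
      using lim cone by (auto simp: is_limit_def)
    show "L \<in> Obj C" using p homD by blast
    fix A u v assume "u \<in> hom C A X" "v \<in> hom C A Y"
    then have "is_cone J C D A (\<lambda>j. if j = 0 then u else v)" by (simp add: cone)
    then have "\<exists>!h. h \<in> hom C A L \<and> (\<forall>j\<in>Obj J. p j \<cdot> h = (if j = 0 then u else v))"
      using lim unfolding is_limit_def by blast
    then show "\<exists>!h. h \<in> hom C A L \<and> p 0 \<cdot> h = u \<and> p 1 \<cdot> h = v"
      using lim by (simp add: J_def)
  qed
  then show ?thesis ..
qed

lemma pullback_exists:
  assumes f: "f \<in> hom C X Z" and g: "g \<in> hom C Y Z"
  shows "\<exists>p q. is_pullback C f g p q"
proof -
  \<comment> \<open>In the shape of a cospan, \<open>0\<close>, \<open>1\<close>, \<open>2\<close> name the objects and their identities, and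
    \<open>3 : 0 \<rightarrow> 2\<close> and \<open>4 : 1 \<rightarrow> 2\<close> are the two legs.\<close>
  define J :: "(nat, nat) cat" where
    "J = \<lparr>Obj = {0, 1, 2}, Arr = {0, 1, 2, 3, 4},
          Dom = (\<lambda>n. if n = 3 then 0 else if n = 4 then 1 else n),
          Cod = (\<lambda>n. if n = 3 \<or> n = 4 then 2 else n),
          Ide = id, Cmp = (\<lambda>n m. if m = 3 \<or> m = 4 then m else n)\<rparr>"
  define x where "x = (\<lambda>j::nat. if j = 0 then X else if j = 1 then Y else Z)"
  define D where "D = \<lparr>on_obj = x,
    on_arr = (\<lambda>j. if j = 3 then f else if j = 4 then g else Ide C (x j))\<rparr>"
  note XYZ = homD(4)[OF f] homD(4)[OF g] homD(5)[OF f]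
  have J: "category J" by unfold_locales (auto simp: J_def hom_def split: if_splits)
  have F: "is_functor J C D"
    using XYZ[THEN ide_hom] XYZ[THEN ide_hom, THEN cmp_ide_hom] XYZ f g
      cmp_ide_hom[OF f] cmp_ide_hom[OF g] ide_cmp_hom[OF f] ide_cmp_hom[OF g]
    by (auto simp: is_functor_def J_def D_def x_def)
  have cone: "is_cone J C D L p \<longleftrightarrow>
      p 0 \<in> hom C L X \<and> p 1 \<in> hom C L Y \<and> f \<cdot> p 0 = p 2 \<and> g \<cdot> p 1 = p 2" for L p
  proof -
    have "p 2 \<in> hom C L Z" if "p 0 \<in> hom C L X" "f \<cdot> p 0 = p 2"
      using cmp_hom[OF that(1) f] that(2) by simp
    then show ?thesis
    using homD(4)[of "p 0" L X] ide_cmp_hom[of "p 0" L X] ide_cmp_hom[of "p 1" L Y]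
      ide_cmp_hom[of "p 2" L Z]
      by (auto simp: is_cone_def J_def D_def x_def)
  qed
  obtain L p where lim: "is_limit J C D L p"
    using finite_limits[OF J _ _ F] by (auto simp: J_def)
  then have p: "p 0 \<in> hom C L X" "p 1 \<in> hom C L Y" "f \<cdot> p 0 = p 2" "g \<cdot> p 1 = p 2"
    using cone by (auto simp: is_limit_def)
  have univ: "\<exists>!h. h \<in> hom C A L \<and> p 0 \<cdot> h = u \<and> p 1 \<cdot> h = v"
    if uv: "u \<in> hom C A X" "v \<in> hom C A Y" "f \<cdot> u = g \<cdot> v" for A u v
  proof -
    have "is_cone J C D A (\<lambda>j. if j = 0 then u else if j = 1 then v else f \<cdot> u)"
      using uv by (simp add: cone)
    then have ex: "\<exists>!h. h \<in> hom C A L \<and> (\<forall>j\<in>Obj J. p j \<cdot> h =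
        (if j = 0 then u else if j = 1 then v else f \<cdot> u))"
      using lim unfolding is_limit_def by blast
    have "p 2 \<cdot> h = f \<cdot> u" if "h \<in> hom C A L" "p 0 \<cdot> h = u" for h
      using hom_assoc[OF that(1) p(1) f] that p by simp
    then have "h \<in> hom C A L \<and> (\<forall>j\<in>Obj J. p j \<cdot> h =
        (if j = 0 then u else if j = 1 then v else f \<cdot> u)) \<longleftrightarrow>
        h \<in> hom C A L \<and> p 0 \<cdot> h = u \<and> p 1 \<cdot> h = v" for h
      by (auto simp: J_def)
    then show ?thesis using ex by simp
  qed
  have "is_pullback C f g (p 0) (p 1)"
    unfolding is_pullback_def
    using univ p homD[OF f] homD[OF g] homD[OF p(1)] by auto
  then show ?thesis by blast
qed

section \<open>Pairings\<close>

lemma is_product_Prod: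
  assumes "X \<in> Obj C" "Y \<in> Obj C"
  shows "is_product C X Y (Prod C X Y, pr0 C X Y, pr1 C X Y)"
  using someI_ex[OF product_exists[OF assms]]
  by (simp add: Prod_def pr0_def pr1_def chosen_product_def)

lemma pr0_hom: "X \<in> Obj C \<Longrightarrow> Y \<in> Obj C \<Longrightarrow> pr0 C X Y \<in> hom C (Prod C X Y) X"
  using is_product_Prod by (simp add: is_product_def)

lemma pr1_hom: "X \<in> Obj C \<Longrightarrow> Y \<in> Obj C \<Longrightarrow> pr1 C X Y \<in> hom C (Prod C X Y) Y"
  using is_product_Prod by (simp add: is_product_def)

lemma pairing:
  assumes u: "u \<in> hom C A X" and v: "v \<in> hom C A Y"
  shows pairing_hom: "pairing C u v \<in> hom C A (Prod C X Y)"
    and pr0_pairing: "pr0 C X Y \<cdot> pairing C u v = u"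
    and pr1_pairing: "pr1 C X Y \<cdot> pairing C u v = v"
    and pairing_unique: "\<And>h. h \<in> hom C A (Prod C X Y) \<Longrightarrow> pr0 C X Y \<cdot> h = u \<Longrightarrow>
      pr1 C X Y \<cdot> h = v \<Longrightarrow> pairing C u v = h"
proof -
  have ex: "\<exists>!h. h \<in> hom C A (Prod C X Y) \<and> pr0 C X Y \<cdot> h = u \<and> pr1 C X Y \<cdot> h = v"
    using is_product_Prod[of X Y] homD[OF u] homD[OF v] u v unfolding is_product_def by simp
  have eq: "pairing C u v =
    (THE h. h \<in> hom C A (Prod C X Y) \<and> pr0 C X Y \<cdot> h = u \<and> pr1 C X Y \<cdot> h = v)"
    using homD[OF u] homD[OF v] by (simp add: pairing_def)
  show "pairing C u v \<in> hom C A (Prod C X Y)" "pr0 C X Y \<cdot> pairing C u v = u"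
    "pr1 C X Y \<cdot> pairing C u v = v"
    using theI'[OF ex] by (simp_all add: eq)
  show "pairing C u v = h" if "h \<in> hom C A (Prod C X Y)" "pr0 C X Y \<cdot> h = u"
    "pr1 C X Y \<cdot> h = v" for h
    using the1_equality[OF ex] that by (simp add: eq)
qed

lemma pairing_cmp:
  assumes u: "u \<in> hom C A X" and v: "v \<in> hom C A Y" and h: "h \<in> hom C B A"
  shows "pairing C u v \<cdot> h = pairing C (u \<cdot> h) (v \<cdot> h)"
proof -
  note XY = homD(5)[OF u] homD(5)[OF v]
  have "pairing C (u \<cdot> h) (v \<cdot> h) = pairing C u v \<cdot> h"
    using hom_assoc[OF h pairing_hom[OF u v] pr0_hom[OF XY]]
      hom_assoc[OF h pairing_hom[OF u v] pr1_hom[OF XY]]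
      pr0_pairing[OF u v] pr1_pairing[OF u v]
    by (intro pairing_unique[OF cmp_hom[OF h u] cmp_hom[OF h v] cmp_hom[OF h pairing_hom[OF u v]]])
      simp_all
  then show ?thesis by simp
qed

lemma pairing_surj:
  assumes w: "w \<in> hom C A (Prod C X Y)" and X: "X \<in> Obj C" and Y: "Y \<in> Obj C"
  obtains u v where "u \<in> hom C A X" "v \<in> hom C A Y" "w = pairing C u v"
proof
  show u: "pr0 C X Y \<cdot> w \<in> hom C A X" and v: "pr1 C X Y \<cdot> w \<in> hom C A Y"
    using w pr0_hom[OF X Y] pr1_hom[OF X Y] cmp_hom by blast+
  show "w = pairing C (pr0 C X Y \<cdot> w) (pr1 C X Y \<cdot> w)"
    using pairing_unique[OF u v w] by simp
qed

lemma pairing_inject: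
  assumes "u \<in> hom C A X" "v \<in> hom C A Y" "u' \<in> hom C A X" "v' \<in> hom C A Y"
    and "pairing C u v = pairing C u' v'"
  shows "u = u' \<and> v = v'"
  using pr0_pairing pr1_pairing assms by metis

lemma square_map_hom:
  assumes f: "f \<in> hom C X Y"
  shows "square_map C f \<in> hom C (Prod C X X) (Prod C Y Y)"
  unfolding square_map_def homD(2)[OF f]
  using homD(4)[OF f] by (intro pairing_hom cmp_hom[OF _ f] pr0_hom pr1_hom)

lemma square_map_pairing:
  assumes f: "f \<in> hom C X Y" and a: "a \<in> hom C A X" and b: "b \<in> hom C A X"
  shows "square_map C f \<cdot> pairing C a b = pairing C (f \<cdot> a) (f \<cdot> b)"
proof -
  note X = homD(4)[OF f]
  note p0 = pr0_hom[OF X X] and p1 = pr1_hom[OF X X] and ab = pairing_hom[OF a b]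
  have "square_map C f \<cdot> pairing C a b =
      pairing C ((f \<cdot> pr0 C X X) \<cdot> pairing C a b) ((f \<cdot> pr1 C X X) \<cdot> pairing C a b)"
    unfolding square_map_def homD(2)[OF f]
    by (rule pairing_cmp[OF cmp_hom[OF p0 f] cmp_hom[OF p1 f] ab])
  then show ?thesis
    using hom_assoc[OF ab p0 f] hom_assoc[OF ab p1 f] pr0_pairing[OF a b] pr1_pairing[OF a b]
    by simp
qed

end

section \<open>Subobjects and generalized elements\<close>

definition factors :: "('o, 'a) cat \<Rightarrow> 'a \<Rightarrow> 'a \<Rightarrow> bool" where
  "factors C w m \<longleftrightarrow> (\<exists>k \<in> hom C (Dom C w) (Dom C m). m \<cdot>\<^bsub>C\<^esub> k = w)"

context category
begin

lemma factorsI: "k \<in> hom C A (Dom C m) \<Longrightarrow> m \<in> Arr C \<Longrightarrow> m \<cdot> k = w \<Longrightarrow> factors C w m"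
  using homD(2)[OF cmp_hom[OF _ homI]] by (auto simp: factors_def)

lemma factors_refl: "m \<in> Arr C \<Longrightarrow> factors C m m"
  using ide_hom[OF dom_obj] cmp_ide by (auto simp: factors_def)

lemma factors_trans:
  assumes "factors C w m" "factors C m n" "n \<in> Arr C"
  shows "factors C w n"
proof -
  obtain k l where k: "k \<in> hom C (Dom C w) (Dom C m)" "m \<cdot> k = w"
    and l: "l \<in> hom C (Dom C m) (Dom C n)" "n \<cdot> l = m"
    using assms by (auto simp: factors_def)
  have "n \<cdot> (l \<cdot> k) = w" using hom_assoc[OF k(1) l(1) homI[OF assms(3)]] k l by simp
  then show ?thesis using cmp_hom[OF k(1) l(1)] by (auto simp: factors_def)
qed

lemma factors_cmp:
  assumes w: "factors C w m" and h: "h \<in> hom C B (Dom C w)" and "w \<in> Arr C" "m \<in> Arr C"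
  shows "factors C (w \<cdot> h) m"
  using factors_trans[OF factorsI[OF h] w] assms by blast

lemma monicD: "monic C m \<Longrightarrow> m \<in> Arr C"
  by (simp add: monic_def)

lemma monos_intoD:
  assumes "m \<in> monos_into C B"
  shows "monic C m" "m \<in> Arr C" "Cod C m = B" "m \<in> hom C (Dom C m) B"
  using assms monicD by (auto simp: monos_into_def hom_def)

lemma monic_cancel:
  "monic C m \<Longrightarrow> g \<in> hom C A (Dom C m) \<Longrightarrow> h \<in> hom C A (Dom C m) \<Longrightarrow> m \<cdot> g = m \<cdot> h \<Longrightarrow> g = h"
  by (auto simp: monic_def)

text \<open>Monomorphisms that factor through each other do so by mutually inverse maps. This replaces
  the isomorphisms in the definition of a subobject by the preorder of factorization.\<close>

lemma mono_iso_iff: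
  "(m, n) \<in> mono_iso C B \<longleftrightarrow>
     m \<in> monos_into C B \<and> n \<in> monos_into C B \<and> factors C m n \<and> factors C n m"
proof
  assume "(m, n) \<in> mono_iso C B"
  then obtain i j where mn: "m \<in> monos_into C B" "n \<in> monos_into C B"
    and i: "i \<in> hom C (Dom C m) (Dom C n)" "n \<cdot> i = m"
    and j: "j \<in> hom C (Dom C n) (Dom C m)" "i \<cdot> j = Ide C (Dom C n)"
    unfolding mono_iso_def is_iso_def by (auto simp: hom_def)
  have n: "n \<in> Arr C" using mn monos_intoD by blast
  have "m \<cdot> j = n" using hom_assoc[OF j(1) i(1) homI[OF n]] i j cmp_ide[OF n] by simp
  then show "m \<in> monos_into C B \<and> n \<in> monos_into C B \<and> factors C m n \<and> factors C n m"
    using mn i j by (auto simp: factors_def)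
next
  assume asm: "m \<in> monos_into C B \<and> n \<in> monos_into C B \<and> factors C m n \<and> factors C n m"
  then have mn: "monic C m" "monic C n" "m \<in> Arr C" "n \<in> Arr C"
    using monos_intoD by blast+
  obtain i j where i: "i \<in> hom C (Dom C m) (Dom C n)" "n \<cdot> i = m"
    and j: "j \<in> hom C (Dom C n) (Dom C m)" "m \<cdot> j = n"
    using asm by (auto simp: factors_def)
  have "j \<cdot> i = Ide C (Dom C m)"
    using hom_assoc[OF i(1) j(1) homI[OF mn(3)]] i j cmp_ide[OF mn(3)]
    by (intro monic_cancel[OF mn(1) cmp_hom[OF i(1) j(1)] ide_hom[OF dom_obj[OF mn(3)]]]) simp
  moreover have "i \<cdot> j = Ide C (Dom C n)"
    using hom_assoc[OF j(1) i(1) homI[OF mn(4)]] i j cmp_ide[OF mn(4)]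
    by (intro monic_cancel[OF mn(2) cmp_hom[OF j(1) i(1)] ide_hom[OF dom_obj[OF mn(4)]]]) simp
  ultimately have "is_iso C i" using i(1) j(1) by (auto simp: is_iso_def hom_def)
  then show "(m, n) \<in> mono_iso C B" using asm i by (auto simp: mono_iso_def)
qed

lemma mono_iso_Image:
  assumes "m \<in> monos_into C B"
  shows "mono_iso C B `` {m} = {n \<in> monos_into C B. factors C m n \<and> factors C n m}"
  using assms by (auto simp: mono_iso_iff)

lemma equiv_mono_iso: "equiv (monos_into C B) (mono_iso C B)"
proof (rule equivI)
  show "refl_on (monos_into C B) (mono_iso C B)"
    unfolding refl_on_def mono_iso_iff using factors_refl monos_intoD by blast
  show "mono_iso C B \<subseteq> monos_into C B \<times> monos_into C B" by (auto simp: mono_iso_def)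
  show "sym (mono_iso C B)" by (auto simp: sym_def mono_iso_iff)
  show "trans (mono_iso C B)"
    unfolding trans_def mono_iso_iff using factors_trans monos_intoD(2) by meson
qed

lemma subobjectI:
  assumes "m \<in> monos_into C B"
    and "\<And>n. n \<in> R \<longleftrightarrow> n \<in> monos_into C B \<and> factors C m n \<and> factors C n m"
  shows "R \<in> subobjects C B"
proof -
  have "R = mono_iso C B `` {m}"
    using assms(2) unfolding mono_iso_Image[OF assms(1)] by blast
  then show ?thesis using quotientI[OF assms(1), of "mono_iso C B"] by (simp add: subobjects_def)
qed

lemma subobject_nonempty: "R \<in> subobjects C B \<Longrightarrow> \<exists>m. m \<in> R"
  using in_quotient_imp_non_empty[OF equiv_mono_iso] by (fastforce simp: subobjects_def)

lemma subobject_eq: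
  assumes "R \<in> subobjects C B" "m \<in> R"
  shows "R = {n \<in> monos_into C B. factors C m n \<and> factors C n m}"
proof -
  have "m \<in> monos_into C B"
    using assms in_quotient_imp_subset[OF equiv_mono_iso] by (fastforce simp: subobjects_def)
  moreover have "R = mono_iso C B `` {m}"
  proof -
    obtain r where r: "R = mono_iso C B `` {r}"
      using assms(1) by (auto simp: subobjects_def elim: quotientE)
    then show ?thesis using assms(2) equiv_class_eq[OF equiv_mono_iso] by simp
  qed
  ultimately show ?thesis by (simp add: mono_iso_Image)
qed

lemma subobject_monic:
  assumes "R \<in> subobjects C B" "m \<in> R"
  shows "monic C m" "m \<in> Arr C" "Cod C m = B" "m \<in> hom C (Dom C m) B"
  using monos_intoD subobject_eq[OF assms] assms(2) by blast+

lemma subobject_factors: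
  assumes "R \<in> subobjects C B" "m \<in> R" "n \<in> R"
  shows "factors C m n"
  using assms subobject_eq[OF assms(1,2)] by auto

lemma subobject_factors_cong:
  assumes "R \<in> subobjects C B" "n \<in> R" "n' \<in> R"
  shows "factors C w n \<longleftrightarrow> factors C w n'"
  using factors_trans[OF _ subobject_factors[OF assms] subobject_monic(2)[OF assms(1,3)]]
    factors_trans[OF _ subobject_factors[OF assms(1,3,2)] subobject_monic(2)[OF assms(1,2)]]
  by blast

text \<open>Factorization does not depend on representatives, so inclusion of relations can be tested on
  any of them.\<close>

lemma sub_le_factors:
  assumes "R \<in> subobjects C B" "S \<in> subobjects C B" "m \<in> R" "n \<in> S"
  shows "sub_le C R S \<longleftrightarrow> factors C m n"
proof
  assume "sub_le C R S"
  then obtain m' n' where "m' \<in> R" "n' \<in> S" "factors C m' n'"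
    by (auto simp: sub_le_def factors_def)
  then have "factors C m n'"
    using factors_trans[OF subobject_factors[OF assms(1,3)]] subobject_monic(2)[OF assms(2)]
    by blast
  then show "factors C m n"
    using subobject_factors_cong[OF assms(2,4) \<open>n' \<in> S\<close>] by simp
qed (use assms in \<open>auto simp: sub_le_def factors_def\<close>)

lemma sub_le_antisym:
  assumes "R \<in> subobjects C B" "S \<in> subobjects C B" "sub_le C R S" "sub_le C S R"
  shows "R = S"
proof -
  obtain m n where mn: "m \<in> R" "n \<in> S" using assms subobject_nonempty by blast
  then have f: "factors C m n" "factors C n m" using sub_le_factors assms by auto
  then have "n \<in> R"
    using mn assms subobject_eq[OF assms(1) mn(1)] subobject_monic[OF assms(2) mn(2)]
    by (auto simp: monos_into_def)
  then have "R = {k \<in> monos_into C B. factors C n k \<and> factors C k n}"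
    using subobject_eq assms by blast
  then show ?thesis using subobject_eq[OF assms(2) mn(2)] by simp
qed

end

context finitely_complete_category
begin

lemma hom_rel_hom: "(a, b) \<in> hom_rel C A X R \<Longrightarrow> a \<in> hom C A X \<and> b \<in> hom C A X"
  by (simp add: hom_rel_def)

lemma hom_rel_factors:
  assumes R: "R \<in> relations C X" and m: "m \<in> R" and a: "a \<in> hom C A X" and b: "b \<in> hom C A X"
  shows "(a, b) \<in> hom_rel C A X R \<longleftrightarrow> factors C (pairing C a b) m"
proof -
  have d: "Dom C (pairing C a b) = A" using homD(2)[OF pairing_hom[OF a b]] .
  have "(a, b) \<in> hom_rel C A X R \<longleftrightarrow> (\<exists>n \<in> R. factors C (pairing C a b) n)"
    using a b d by (auto simp: hom_rel_def factors_def)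
  then show ?thesis
    using m subobject_factors_cong[OF R[unfolded relations_def] m] by blast
qed

text \<open>The Yoneda principle for relations: inclusion can be tested on generalized elements.
  For the converse, the pair of projections of \<open>R\<close> is the generic element of \<open>R\<close>.\<close>

lemma sub_le_hom_rel:
  assumes R: "R \<in> relations C X" and S: "S \<in> relations C X" and X: "X \<in> Obj C"
  shows "sub_le C R S \<longleftrightarrow> (\<forall>A. hom_rel C A X R \<subseteq> hom_rel C A X S)"
proof -
  obtain m n where m: "m \<in> R" and n: "n \<in> S"
    using R S subobject_nonempty unfolding relations_def by blast
  note mono = subobject_monic[OF R[unfolded relations_def] m]
  have le: "sub_le C R S \<longleftrightarrow> factors C m n"
    using sub_le_factors R S m n by (simp add: relations_def)
  show ?thesis
  proof
    assume "sub_le C R S"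
    then have "factors C w m \<Longrightarrow> factors C w n" for w
      using le factors_trans subobject_monic(2)[OF S[unfolded relations_def] n] by blast
    then show "\<forall>A. hom_rel C A X R \<subseteq> hom_rel C A X S"
      using hom_rel_factors[OF R m] hom_rel_factors[OF S n] hom_rel_hom by (meson subrelI)
  next
    assume sub: "\<forall>A. hom_rel C A X R \<subseteq> hom_rel C A X S"
    obtain a b where ab: "a \<in> hom C (Dom C m) X" "b \<in> hom C (Dom C m) X" "m = pairing C a b"
      using pairing_surj[OF mono(4) X X] .
    then show "sub_le C R S"
      using le hom_rel_factors[OF R m ab(1,2)] hom_rel_factors[OF S n ab(1,2)] sub
        factors_refl[OF mono(2)] by auto
  qed
qed

lemma rel_eqI:
  assumes "R \<in> relations C X" "S \<in> relations C X" "X \<in> Obj C"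
    and "\<And>A. hom_rel C A X R = hom_rel C A X S"
  shows "R = S"
  using assms sub_le_antisym sub_le_hom_rel by (simp add: relations_def)

lemma hom_rel_precomp:
  assumes R: "R \<in> relations C X" and ab: "(a, b) \<in> hom_rel C A X R" and h: "h \<in> hom C B A"
  shows "(a \<cdot> h, b \<cdot> h) \<in> hom_rel C B X R"
proof -
  obtain m where m: "m \<in> R" using R subobject_nonempty by (auto simp: relations_def)
  have a: "a \<in> hom C A X" and b: "b \<in> hom C A X" using hom_rel_hom[OF ab] by auto
  note p = homD[OF pairing_hom[OF a b]]
  have "factors C (pairing C a b \<cdot> h) m"
    using ab h p hom_rel_factors[OF R m a b] subobject_monic(2)[OF R[unfolded relations_def] m]
    by (auto intro!: factors_cmp)
  then show ?thesis
    using hom_rel_factors[OF R m cmp_hom[OF h a] cmp_hom[OF h b]] pairing_cmp[OF a b h] by simp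
qed

lemma sub_class_rel:
  assumes "m \<in> monos_into C (Prod C X X)"
  shows "sub_class C m \<in> relations C X" "m \<in> sub_class C m"
proof -
  have m: "m \<in> Arr C" "Cod C m = Prod C X X" using assms monos_intoD by blast+
  show "sub_class C m \<in> relations C X" unfolding relations_def
    by (rule subobjectI[OF assms]) (simp add: sub_class_def m mono_iso_Image[OF assms])
  show "m \<in> sub_class C m"
    using assms m factors_refl by (simp add: sub_class_def mono_iso_Image)
qed

lemma diagonal_rel:
  assumes X: "X \<in> Obj C"
  shows diagonal_rel_rel: "diagonal_rel C X \<in> relations C X"
    and hom_rel_diagonal: "(a, b) \<in> hom_rel C A X (diagonal_rel C X) \<longleftrightarrow> a = b \<and> a \<in> hom C A X"
proof -
  let ?d = "pairing C (Ide C X) (Ide C X)"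
  have i: "Ide C X \<in> hom C X X" using ide_hom X .
  have d: "?d \<in> hom C X (Prod C X X)" using pairing_hom[OF i i] .
  have dc: "?d \<cdot> c = pairing C c c" if "c \<in> hom C A X" for c A
    using pairing_cmp[OF i i that] ide_cmp_hom[OF that] by simp
  have "monic C ?d"
    unfolding monic_def homD(2)[OF d] using dc pairing_inject homD(1)[OF d] by metis
  then have mono: "?d \<in> monos_into C (Prod C X X)" using homD[OF d] by (simp add: monos_into_def)
  then show R: "diagonal_rel C X \<in> relations C X" using sub_class_rel by (simp add: diagonal_rel_def)
  have fac: "factors C (pairing C a b) ?d \<longleftrightarrow> a = b" if "a \<in> hom C A X" "b \<in> hom C A X" for a b
    unfolding factors_def homD(2)[OF pairing_hom[OF that]] homD(2)[OF d]
    using dc pairing_inject that by metis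
  show "(a, b) \<in> hom_rel C A X (diagonal_rel C X) \<longleftrightarrow> a = b \<and> a \<in> hom C A X"
    using hom_rel_factors[OF R _ ] sub_class_rel(2)[OF mono] fac hom_rel_hom
    unfolding diagonal_rel_def by metis
qed

text \<open>A pullback of \<open>n\<close> along \<open>g\<close> is exactly a monomorphism that represents the maps \<open>w\<close> with
  \<open>g \<cdot> w\<close> in the subobject \<open>n\<close>.\<close>

lemma pullback_monic_iff:
  assumes n: "monic C n" and nB: "Cod C n = B" and g: "g \<in> hom C D B"
  shows "(\<exists>k. is_pullback C g n m k) \<longleftrightarrow> m \<in> monos_into C D \<and>
     (\<forall>A. \<forall>w \<in> hom C A D. factors C w m \<longleftrightarrow> factors C (g \<cdot> w) n)" (is "?L \<longleftrightarrow> ?R")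
proof
  note nh = homI[OF monicD[OF n], unfolded nB]
  assume ?L
  then obtain k where pb: "is_pullback C g n m k" ..
  then obtain P where m: "m \<in> hom C P D" and k: "k \<in> hom C P (Dom C n)"
    using homD(2)[OF g] by (auto simp: is_pullback_def)
  have gm: "g \<cdot> m = n \<cdot> k" using pb by (simp add: is_pullback_def)
  have univ: "\<exists>!h. h \<in> hom C A P \<and> m \<cdot> h = u \<and> k \<cdot> h = v"
    if "u \<in> hom C A D" "v \<in> hom C A (Dom C n)" "g \<cdot> u = n \<cdot> v" for A u v
    using pb that by (simp add: is_pullback_def homD(2)[OF g] homD(2)[OF m])
  have gmh: "g \<cdot> (m \<cdot> h) = n \<cdot> (k \<cdot> h)" if h: "h \<in> hom C A P" for A h
    using hom_assoc[OF h m g] hom_assoc[OF h k nh] gm by simp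
  have "h = h'" if h: "h \<in> hom C A P" and h': "h' \<in> hom C A P" and eq: "m \<cdot> h = m \<cdot> h'" for A h h'
  proof -
    have "k \<cdot> h = k \<cdot> h'"
      using monic_cancel[OF n cmp_hom[OF h k] cmp_hom[OF h' k]] gmh[OF h] gmh[OF h'] eq by simp
    then show ?thesis
      using univ[OF cmp_hom[OF h m] cmp_hom[OF h k] gmh[OF h]] h h' eq by metis
  qed
  then have "m \<in> monos_into C D"
    using homD[OF m] unfolding monos_into_def monic_def by blast
  moreover have "factors C w m \<longleftrightarrow> factors C (g \<cdot> w) n" if w: "w \<in> hom C A D" for A w
  proof
    assume "factors C w m"
    then obtain h where h: "h \<in> hom C A P" "m \<cdot> h = w"
      unfolding factors_def homD(2)[OF w] homD(2)[OF m] by blast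
    then show "factors C (g \<cdot> w) n"
      using gmh[OF h(1)] by (intro factorsI[OF cmp_hom[OF h(1) k] monicD[OF n]]) simp
  next
    assume "factors C (g \<cdot> w) n"
    then obtain v where v: "v \<in> hom C A (Dom C n)" "n \<cdot> v = g \<cdot> w"
      unfolding factors_def homD(2)[OF cmp_hom[OF w g]] by blast
    then obtain h where "h \<in> hom C A P" "m \<cdot> h = w" using univ[OF w v(1) v(2)[symmetric]] by blast
    then show "factors C w m" unfolding factors_def homD(2)[OF w] homD(2)[OF m] by blast
  qed
  ultimately show ?R by blast
next
  note nh = homI[OF monicD[OF n], unfolded nB]
  assume R: ?R
  then have mm: "monic C m" and m: "m \<in> hom C (Dom C m) D"
    using monos_intoD by blast+
  have "factors C (g \<cdot> m) n" using R m factors_refl[OF homD(1)[OF m]] by blast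
  then obtain k where k: "k \<in> hom C (Dom C m) (Dom C n)" "n \<cdot> k = g \<cdot> m"
    unfolding factors_def homD(2)[OF cmp_hom[OF m g]] by blast
  have "\<exists>!h. h \<in> hom C A (Dom C m) \<and> m \<cdot> h = u \<and> k \<cdot> h = v"
    if u: "u \<in> hom C A D" and v: "v \<in> hom C A (Dom C n)" and eq: "g \<cdot> u = n \<cdot> v" for A u v
  proof -
    have "factors C u m" using R u factorsI[OF v monicD[OF n] eq[symmetric]] by blast
    then obtain h where h: "h \<in> hom C A (Dom C m)" "m \<cdot> h = u"
      unfolding factors_def homD(2)[OF u] by blast
    have "n \<cdot> (k \<cdot> h) = n \<cdot> v"
      using hom_assoc[OF h(1) k(1) nh] hom_assoc[OF h(1) m g] h k eq by simp
    then have "k \<cdot> h = v" using monic_cancel[OF n cmp_hom[OF h(1) k(1)] v] by blast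
    then show ?thesis using h monic_cancel[OF mm] by metis
  qed
  then have "is_pullback C g n m k"
    unfolding is_pullback_def homD(2,3)[OF g] nB
    using homD(1)[OF g] monicD[OF n] m k by (intro conjI allI ballI impI) auto
  then show ?L ..
qed

text \<open>Being a pullback of a representative of \<open>S\<close> is a condition on which maps factor through the
  monomorphism, so the pullbacks form one isomorphism class.\<close>

lemma inverse_image:
  assumes f: "f \<in> hom C X Y" and S: "S \<in> relations C Y"
  shows inverse_image_rel: "inverse_image C f S \<in> relations C X"
    and hom_rel_inverse_image:
      "(a, b) \<in> hom_rel C A X (inverse_image C f S) \<longleftrightarrow>
         a \<in> hom C A X \<and> b \<in> hom C A X \<and> (f \<cdot> a, f \<cdot> b) \<in> hom_rel C A Y S"
proof -
  note S' = S[unfolded relations_def] and g = square_map_hom[OF f]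
  have iff: "m \<in> inverse_image C f S \<longleftrightarrow> m \<in> monos_into C (Prod C X X) \<and>
     (\<forall>A. \<forall>w \<in> hom C A (Prod C X X). factors C w m \<longleftrightarrow> factors C (square_map C f \<cdot> w) n)"
    if n: "n \<in> S" for m n
  proof -
    show ?thesis
      using subobject_factors_cong[OF S' n] n pullback_monic_iff[OF subobject_monic(1)[OF S'] subobject_monic(3)[OF S'] g, of _ m]
      unfolding inverse_image_def by blast
  qed
  obtain n where n: "n \<in> S" using S' subobject_nonempty by blast
  obtain m where m: "m \<in> inverse_image C f S"
    using pullback_exists[OF g subobject_monic(4)[OF S' n]] n by (auto simp: inverse_image_def)
  have mm: "m \<in> monos_into C (Prod C X X)" using iff[OF n] m by blast
  show R: "inverse_image C f S \<in> relations C X"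
    unfolding relations_def
  proof (rule subobjectI[OF mm])
    fix m'
    show "m' \<in> inverse_image C f S \<longleftrightarrow>
      m' \<in> monos_into C (Prod C X X) \<and> factors C m m' \<and> factors C m' m"
    proof
      assume m': "m' \<in> inverse_image C f S"
      then have mm': "m' \<in> monos_into C (Prod C X X)" using iff[OF n] by blast
      have eq: "factors C w m = factors C w m'" if "w \<in> hom C A (Prod C X X)" for A w
        using iff[OF n] m m' that by blast
      have "m \<in> hom C (Dom C m) (Prod C X X)" "m' \<in> hom C (Dom C m') (Prod C X X)"
        using mm mm' monos_intoD by blast+
      then show "m' \<in> monos_into C (Prod C X X) \<and> factors C m m' \<and> factors C m' m"
        using mm' eq factors_refl homD(1) by blast
    next
      assume m': "m' \<in> monos_into C (Prod C X X) \<and> factors C m m' \<and> factors C m' m"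
      then have "m' \<in> Arr C" "m \<in> Arr C" using mm monos_intoD by blast+
      then have "factors C w m' = factors C w m" for w using factors_trans m' by blast
      then show "m' \<in> inverse_image C f S" using m m' iff[OF n] by simp
    qed
  qed
  show "(a, b) \<in> hom_rel C A X (inverse_image C f S) \<longleftrightarrow>
         a \<in> hom C A X \<and> b \<in> hom C A X \<and> (f \<cdot> a, f \<cdot> b) \<in> hom_rel C A Y S"
  proof (cases "a \<in> hom C A X \<and> b \<in> hom C A X")
    case True
    then have a: "a \<in> hom C A X" and b: "b \<in> hom C A X" by auto
    have "factors C (pairing C a b) m = factors C (pairing C (f \<cdot> a) (f \<cdot> b)) n"
      using iff[OF n] m pairing_hom[OF a b] square_map_pairing[OF f a b] by force
    then show ?thesis
      using hom_rel_factors[OF R m a b] hom_rel_factors[OF S n cmp_hom[OF a f] cmp_hom[OF b f]] a b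
      by simp
  qed (auto simp: hom_rel_def)
qed

lemma hom_rel_kernel:
  assumes f: "f \<in> hom C X Y"
  shows "(a, b) \<in> hom_rel C A X (kernel_rel C f) \<longleftrightarrow>
    a \<in> hom C A X \<and> b \<in> hom C A X \<and> f \<cdot> a = f \<cdot> b"
  unfolding kernel_rel_def homD(3)[OF f]
    hom_rel_inverse_image[OF f diagonal_rel_rel[OF homD(5)[OF f]]]
    hom_rel_diagonal[OF homD(5)[OF f]]
  using cmp_hom[OF _ f] by auto

lemma kernel_rel_rel: "f \<in> hom C X Y \<Longrightarrow> kernel_rel C f \<in> relations C X"
  using inverse_image_rel[OF _ diagonal_rel_rel] homD by (metis kernel_rel_def)

end

section \<open>Internal orders\<close>

text \<open>The flag \<open>sy\<close> asks for symmetry: \<open>False\<close> gives preorders and \<open>True\<close> equivalence relations, so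
  that one proof serves for both. When \<open>A\<close> is not an object, \<open>hom C A X\<close> is empty and the conditions
  at \<open>A\<close> hold trivially.\<close>

definition internal_order :: "('o, 'a) cat \<Rightarrow> bool \<Rightarrow> 'o \<Rightarrow> 'a set \<Rightarrow> bool" where
  "internal_order C sy X R \<longleftrightarrow> R \<in> relations C X \<and>
     (\<forall>A. (\<forall>a \<in> hom C A X. (a, a) \<in> hom_rel C A X R) \<and>
          trans (hom_rel C A X R) \<and> (sy \<longrightarrow> sym (hom_rel C A X R)))"

lemma internal_order_rel: "internal_order C sy X R \<Longrightarrow> R \<in> relations C X"
  by (simp add: internal_order_def)

lemma internal_order_refl:
  "internal_order C sy X R \<Longrightarrow> a \<in> hom C A X \<Longrightarrow> (a, a) \<in> hom_rel C A X R"
  by (simp add: internal_order_def)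

lemma internal_order_trans:
  "internal_order C sy X R \<Longrightarrow> (a, b) \<in> hom_rel C A X R \<Longrightarrow> (b, c) \<in> hom_rel C A X R \<Longrightarrow>
    (a, c) \<in> hom_rel C A X R"
  unfolding internal_order_def by (blast dest: transD)

lemma internal_order_sym:
  "internal_order C sy X R \<Longrightarrow> sy \<Longrightarrow> (a, b) \<in> hom_rel C A X R \<Longrightarrow> (b, a) \<in> hom_rel C A X R"
  unfolding internal_order_def by (blast dest: symD)

lemma internal_orderI:
  assumes "R \<in> relations C X"
    and "\<And>A a. a \<in> hom C A X \<Longrightarrow> (a, a) \<in> hom_rel C A X R"
    and "\<And>A a b c. (a, b) \<in> hom_rel C A X R \<Longrightarrow> (b, c) \<in> hom_rel C A X R \<Longrightarrow> (a, c) \<in> hom_rel C A X R"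
    and "\<And>A a b. sy \<Longrightarrow> (a, b) \<in> hom_rel C A X R \<Longrightarrow> (b, a) \<in> hom_rel C A X R"
  shows "internal_order C sy X R"
  unfolding internal_order_def using assms by (blast intro: transI symI)

context finitely_complete_category
begin

lemma reflexive_rel_iff:
  assumes X: "X \<in> Obj C"
  shows "reflexive_rel C X R \<longleftrightarrow>
    R \<in> relations C X \<and> (\<forall>A. \<forall>a \<in> hom C A X. (a, a) \<in> hom_rel C A X R)"
proof -
  have "sub_le C (diagonal_rel C X) R \<longleftrightarrow> (\<forall>A. \<forall>a \<in> hom C A X. (a, a) \<in> hom_rel C A X R)"
    if "R \<in> relations C X"
    unfolding sub_le_hom_rel[OF diagonal_rel_rel[OF X] that X]
    using hom_rel_diagonal[OF X] by fastforce
  then show ?thesis by (auto simp: reflexive_rel_def)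
qed

lemma transitive_rel_iff:
  "transitive_rel C X R \<longleftrightarrow> R \<in> relations C X \<and> (\<forall>A. trans (hom_rel C A X R))"
proof -
  have "trans (hom_rel C A X R)" if "A \<notin> Obj C" for A
    using that homD(4) hom_rel_hom unfolding trans_def by blast
  then show ?thesis unfolding transitive_rel_def by blast
qed

text \<open>The opposite of the generic element of \<open>R\<close> lies in \<open>R\<close> precisely when the opposite of every
  element does, since all elements are obtained from the generic one by precomposition.\<close>

lemma symmetric_rel_iff:
  assumes X: "X \<in> Obj C"
  shows "symmetric_rel C X R \<longleftrightarrow> R \<in> relations C X \<and> (\<forall>A. sym (hom_rel C A X R))"
proof (cases "R \<in> relations C X")
  case R: True
  note R' = R[unfolded relations_def]
  have generic: "\<exists>a b. a \<in> hom C (Dom C m) X \<and> b \<in> hom C (Dom C m) X \<and> m = pairing C a b \<and>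
      pairing C (pr1 C X X \<cdot> m) (pr0 C X X \<cdot> m) = pairing C b a" if m: "m \<in> R" for m
  proof -
    obtain a b where ab: "a \<in> hom C (Dom C m) X" "b \<in> hom C (Dom C m) X" "m = pairing C a b"
      using pairing_surj[OF subobject_monic(4)[OF R' m] X X] .
    then show ?thesis using pr0_pairing[OF ab(1,2)] pr1_pairing[OF ab(1,2)] by metis
  qed
  have le: "sub_le C (opposite_rel C X R) R \<longleftrightarrow> (\<exists>m \<in> R. \<exists>n \<in> R.
      factors C (pairing C (pr1 C X X \<cdot> m) (pr0 C X X \<cdot> m)) n)"
    by (auto simp: sub_le_def opposite_rel_def factors_def)
  have "sub_le C (opposite_rel C X R) R \<longleftrightarrow> (\<forall>A. sym (hom_rel C A X R))"
  proof
    assume "sub_le C (opposite_rel C X R) R"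
    then obtain m n where m: "m \<in> R" and n: "n \<in> R"
      and fac: "factors C (pairing C (pr1 C X X \<cdot> m) (pr0 C X X \<cdot> m)) n"
      using le by blast
    obtain a b where ab: "a \<in> hom C (Dom C m) X" "b \<in> hom C (Dom C m) X" "m = pairing C a b"
      and swap: "pairing C (pr1 C X X \<cdot> m) (pr0 C X X \<cdot> m) = pairing C b a"
      using generic[OF m] by blast
    have ba: "(b, a) \<in> hom_rel C (Dom C m) X R"
      using hom_rel_factors[OF R n ab(2,1)] fac swap by simp
    have "(d, c) \<in> hom_rel C A X R" if cd: "(c, d) \<in> hom_rel C A X R" for A c d
    proof -
      note h = hom_rel_hom[OF cd, THEN conjunct1] hom_rel_hom[OF cd, THEN conjunct2]
      have "factors C (pairing C c d) m" using hom_rel_factors[OF R m h] cd by simp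
      then obtain k where k: "k \<in> hom C A (Dom C m)" "m \<cdot> k = pairing C c d"
        unfolding factors_def homD(2)[OF pairing_hom[OF h]] by blast
      then have "pairing C (a \<cdot> k) (b \<cdot> k) = pairing C c d"
        using pairing_cmp[OF ab(1,2) k(1)] ab(3) by simp
      then have "a \<cdot> k = c \<and> b \<cdot> k = d"
        using pairing_inject[OF cmp_hom[OF k(1) ab(1)] cmp_hom[OF k(1) ab(2)] h] by simp
      then show ?thesis using hom_rel_precomp[OF R ba k(1)] by simp
    qed
    then show "\<forall>A. sym (hom_rel C A X R)" by (blast intro: symI)
  next
    assume sym: "\<forall>A. sym (hom_rel C A X R)"
    obtain m where m: "m \<in> R" using R' subobject_nonempty by blast
    obtain a b where ab: "a \<in> hom C (Dom C m) X" "b \<in> hom C (Dom C m) X" "m = pairing C a b"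
      and swap: "pairing C (pr1 C X X \<cdot> m) (pr0 C X X \<cdot> m) = pairing C b a"
      using generic[OF m] by blast
    have "(a, b) \<in> hom_rel C (Dom C m) X R"
      using hom_rel_factors[OF R m ab(1,2)] ab(3) factors_refl subobject_monic(2)[OF R' m] by simp
    then have "(b, a) \<in> hom_rel C (Dom C m) X R" using sym by (blast dest: symD)
    then have "factors C (pairing C b a) m" using hom_rel_factors[OF R m ab(2,1)] by simp
    then show "sub_le C (opposite_rel C X R) R" using le m swap by force
  qed
  then show ?thesis using R by (simp add: symmetric_rel_def)
qed (simp add: symmetric_rel_def)

lemma preorder_rel_iff:
  "X \<in> Obj C \<Longrightarrow> preorder_rel C X R \<longleftrightarrow> internal_order C False X R"
  unfolding preorder_rel_def internal_order_def
  using reflexive_rel_iff transitive_rel_iff by auto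

lemma equivalence_rel_iff:
  "X \<in> Obj C \<Longrightarrow> equivalence_rel C X R \<longleftrightarrow> internal_order C True X R"
  unfolding equivalence_rel_def preorder_rel_iff unfolding internal_order_def
  using symmetric_rel_iff by auto

lemma internal_order_inverse_image:
  assumes f: "f \<in> hom C X Y" and S: "internal_order C sy Y S"
  shows "internal_order C sy X (inverse_image C f S)"
proof (rule internal_orderI)
  note S' = internal_order_rel[OF S]
  note iff = hom_rel_inverse_image[OF f S']
  show "inverse_image C f S \<in> relations C X" using inverse_image_rel[OF f S'] .
  show "(a, a) \<in> hom_rel C A X (inverse_image C f S)" if "a \<in> hom C A X" for A a
    using iff that internal_order_refl[OF S cmp_hom[OF that f]] by blast
  show "(a, c) \<in> hom_rel C A X (inverse_image C f S)"
    if "(a, b) \<in> hom_rel C A X (inverse_image C f S)"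
      "(b, c) \<in> hom_rel C A X (inverse_image C f S)" for A a b c
    using that internal_order_trans[OF S] unfolding iff by blast
  show "(b, a) \<in> hom_rel C A X (inverse_image C f S)"
    if sy "(a, b) \<in> hom_rel C A X (inverse_image C f S)" for A a b
    using that internal_order_sym[OF S] unfolding iff by blast
qed

lemma internal_order_kernel:
  assumes f: "f \<in> hom C X Y"
  shows "internal_order C sy X (kernel_rel C f)"
  by (rule internal_orderI) (simp_all add: hom_rel_kernel[OF f] kernel_rel_rel[OF f])

lemma inverse_image_mono:
  assumes f: "f \<in> hom C X Y" and S: "S \<in> relations C Y" and W: "W \<in> relations C Y"
    and le: "sub_le C S W"
  shows "sub_le C (inverse_image C f S) (inverse_image C f W)"
  unfolding sub_le_hom_rel[OF inverse_image_rel[OF f S] inverse_image_rel[OF f W] homD(4)[OF f]]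
  using le[unfolded sub_le_hom_rel[OF S W homD(5)[OF f]]]
  by (intro allI subrelI, unfold hom_rel_inverse_image[OF f S] hom_rel_inverse_image[OF f W]) blast

lemma kernel_le_inverse_image:
  assumes f: "f \<in> hom C X Y" and S: "internal_order C sy Y S"
  shows "sub_le C (kernel_rel C f) (inverse_image C f S)"
  unfolding sub_le_hom_rel[OF kernel_rel_rel[OF f]
      inverse_image_rel[OF f internal_order_rel[OF S]] homD(4)[OF f]]
  using internal_order_refl[OF S cmp_hom[OF _ f]]
  by (intro allI subrelI,
      unfold hom_rel_inverse_image[OF f internal_order_rel[OF S]] hom_rel_kernel[OF f]) metis

lemma inverse_image_ide:
  assumes W: "W \<in> relations C Y" and Y: "Y \<in> Obj C"
  shows "inverse_image C (Ide C Y) W = W"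
proof (rule rel_eqI[OF inverse_image_rel[OF ide_hom[OF Y] W] W Y])
  have "(a, b) \<in> hom_rel C A Y (inverse_image C (Ide C Y) W) \<longleftrightarrow> (a, b) \<in> hom_rel C A Y W" for A a b
    unfolding hom_rel_inverse_image[OF ide_hom[OF Y] W] using ide_cmp_hom hom_rel_hom by metis
  then show "hom_rel C A Y (inverse_image C (Ide C Y) W) = hom_rel C A Y W" for A by auto
qed

end

section \<open>Cocartesian maps and joins\<close>

definition order_cat :: "('o, 'a) cat \<Rightarrow> bool \<Rightarrow> (('o, 'a) rel_obj, ('o, 'a) rel_arr) cat" where
  "order_cat C sy = (if sy then Equ C else PrO C)"

lemma order_cat_simps:
  "Dom (order_cat C sy) (A, f, B) = A"
  "Cod (order_cat C sy) (A, f, B) = B"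
  "Cmp (order_cat C sy) (B', g, D) (A, f, B) = (A, g \<cdot>\<^bsub>C\<^esub> f, D)"
  by (simp_all add: order_cat_def Equ_def PrO_def full_subcategory_def Ref_def)

context finitely_complete_category
begin

lemma Obj_order_cat:
  "(X, R) \<in> Obj (order_cat C sy) \<longleftrightarrow> X \<in> Obj C \<and> internal_order C sy X R"
  using preorder_rel_iff[of X R] equivalence_rel_iff[of X R]
  by (auto simp: order_cat_def Equ_def PrO_def full_subcategory_def Ref_def
      equivalence_rel_def preorder_rel_def)

lemma Arr_order_cat:
  "((X, R), f, (Y, S)) \<in> Arr (order_cat C sy) \<longleftrightarrow> internal_order C sy X R \<and>
    internal_order C sy Y S \<and> f \<in> hom C X Y \<and> sub_le C R (inverse_image C f S)"
proof (cases "f \<in> hom C X Y")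
  case True
  then show ?thesis
    using preorder_rel_iff[of X R] equivalence_rel_iff[of X R] preorder_rel_iff[of Y S]
      equivalence_rel_iff[of Y S] homD(4,5)[OF True]
    by (auto simp: order_cat_def Equ_def PrO_def full_subcategory_def Ref_def
        equivalence_rel_def preorder_rel_def)
qed (auto simp: order_cat_def Equ_def PrO_def full_subcategory_def Ref_def)

lemma is_join_order_cat:
  assumes X: "X \<in> Obj C"
  shows "is_join (fibre_order C (order_cat C sy) X) V R T \<longleftrightarrow>
    internal_order C sy X R \<and> internal_order C sy X T \<and> internal_order C sy X V \<and>
    sub_le C R V \<and> sub_le C T V \<and>
    (\<forall>U. internal_order C sy X U \<longrightarrow> sub_le C R U \<longrightarrow> sub_le C T U \<longrightarrow> sub_le C V U)"
  using X by (auto simp: is_join_def fibre_order_def least_def Upper_def Obj_order_cat)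

text \<open>There is at most one arrow above a given map between two given relations, so the universal
  property reduces to an inequality.\<close>

lemma cocartesian_iff_least:
  assumes arr: "((X, T), f, (Y, S)) \<in> Arr (order_cat C sy)"
  shows "cocartesian (order_cat C sy) C ground ((X, T), f, (Y, S)) \<longleftrightarrow>
    (\<forall>W. internal_order C sy Y W \<longrightarrow> sub_le C T (inverse_image C f W) \<longrightarrow> sub_le C S W)"
    (is "?L \<longleftrightarrow> ?R")
proof -
  let ?K = "order_cat C sy"
  have f: "f \<in> hom C X Y" and T: "internal_order C sy X T" and S: "internal_order C sy Y S"
    using arr by (auto simp: Arr_order_cat)
  note Y = homD(5)[OF f]
  \<comment> \<open>The three facts list, in turn, the arrows above the identity, the maps \<open>\<phi>\<close> against which \<open>f\<close> is
    tested, and the possible factorizations \<open>\<psi>\<close>.\<close>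
  have vertical: "((Y, S), Ide C Y, (Y, W)) \<in> Arr ?K \<longleftrightarrow> internal_order C sy Y W \<and> sub_le C S W" for W
    using S ide_hom[OF Y] inverse_image_ide[OF _ Y] internal_order_rel[of C sy Y W]
    by (auto simp: Arr_order_cat)
  have above: "\<phi> \<in> hom ?K (X, T) W \<and> on_arr ground \<phi> = f \<longleftrightarrow>
      (\<exists>W'. W = (Y, W') \<and> \<phi> = ((X, T), f, (Y, W')) \<and> internal_order C sy Y W' \<and>
        sub_le C T (inverse_image C f W'))" for \<phi> W
  proof -
    obtain A g Y' W' where [simp]: "\<phi> = (A, g, (Y', W'))" by (metis prod.exhaust)
    have "g = f \<Longrightarrow> g \<in> hom C X Y' \<Longrightarrow> Y' = Y" using f by (auto simp: hom_def)
    then show ?thesis using f T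
      by (auto simp: hom_def[of ?K] ground_def order_cat_simps Arr_order_cat)
  qed
  have lift: "\<psi> \<in> hom ?K (Y, S) (Y, W) \<and> Cmp ?K \<psi> ((X, T), f, (Y, S)) = ((X, T), f, (Y, W)) \<and>
      on_arr ground \<psi> = Ide C Y \<longleftrightarrow>
      \<psi> = ((Y, S), Ide C Y, (Y, W)) \<and> internal_order C sy Y W \<and> sub_le C S W" for \<psi> W
  proof -
    obtain A g B where [simp]: "\<psi> = (A, g, B)" by (metis prod.exhaust)
    show ?thesis using vertical[of W] ide_cmp_hom[OF f]
      by (auto simp: hom_def ground_def order_cat_simps)
  qed
  have ground: "on_arr ground ((X, T), f, (Y, S)) = f" "on_obj ground (Y, S) = Y"
    by (simp_all add: ground_def)
  have "?L \<longleftrightarrow> (\<forall>W \<phi>. \<phi> \<in> hom ?K (X, T) W \<and> on_arr ground \<phi> = f \<longrightarrow>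
    (\<exists>!\<psi>. \<psi> \<in> hom ?K (Y, S) W \<and> Cmp ?K \<psi> ((X, T), f, (Y, S)) = \<phi> \<and> on_arr ground \<psi> = Ide C Y))"
    unfolding cocartesian_def order_cat_simps ground
    using arr by (simp add: Ball_def imp_conjL del: split_paired_All)
  also have "\<dots> \<longleftrightarrow> (\<forall>W. internal_order C sy Y W \<longrightarrow> sub_le C T (inverse_image C f W) \<longrightarrow>
    (\<exists>!\<psi>. \<psi> \<in> hom ?K (Y, S) (Y, W) \<and> Cmp ?K \<psi> ((X, T), f, (Y, S)) = ((X, T), f, (Y, W)) \<and>
      on_arr ground \<psi> = Ide C Y))"
  proof -
    have "(\<forall>W \<phi>. (\<exists>W'. W = (Y, W') \<and> \<phi> = ((X, T), f, (Y, W')) \<and> P W' \<and> Q W') \<longrightarrow> U W \<phi>) \<longleftrightarrow>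
      (\<forall>W'. P W' \<longrightarrow> Q W' \<longrightarrow> U (Y, W') ((X, T), f, (Y, W')))" for P Q U
      by blast
    then show ?thesis unfolding above .
  qed
  also have "\<dots> \<longleftrightarrow> ?R"
  proof -
    have "(\<exists>!\<psi>. \<psi> = t \<and> P \<and> Q) \<longleftrightarrow> P \<and> Q" for t :: "('o, 'a) rel_arr" and P Q
      by blast
    then show ?thesis unfolding lift by blast
  qed
  finally show ?thesis .
qed

text \<open>Under the two hypotheses on \<open>f\<close>, inverse image is an order isomorphism from the relations of the
  given kind on \<open>Y\<close> to those on \<open>X\<close> above the kernel relation, so it carries the least \<open>W\<close> of
  \<open>cocartesian_iff_least\<close> to the least upper bound of the kernel relation and \<open>T\<close>.\<close>

lemma cocartesian_iff_join:
  assumes arr: "((X, T), f, (Y, S)) \<in> Arr (order_cat C sy)"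
    and reflect: "\<And>S W. S \<in> relations C Y \<Longrightarrow> W \<in> relations C Y \<Longrightarrow>
      sub_le C (inverse_image C f S) (inverse_image C f W) \<Longrightarrow> sub_le C S W"
    and descend: "\<And>V. internal_order C sy X V \<Longrightarrow> sub_le C (kernel_rel C f) V \<Longrightarrow>
      \<exists>W. internal_order C sy Y W \<and> inverse_image C f W = V"
  shows "cocartesian (order_cat C sy) C ground ((X, T), f, (Y, S)) \<longleftrightarrow>
    is_join (fibre_order C (order_cat C sy) X) (inverse_image C f S) (kernel_rel C f) T"
proof -
  have f: "f \<in> hom C X Y" and T: "internal_order C sy X T" and S: "internal_order C sy Y S"
    and TS: "sub_le C T (inverse_image C f S)"
    using arr by (auto simp: Arr_order_cat)
  note X = homD(4)[OF f]
  have "(\<forall>W. internal_order C sy Y W \<longrightarrow> sub_le C T (inverse_image C f W) \<longrightarrow> sub_le C S W) \<longleftrightarrow>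
    (\<forall>U. internal_order C sy X U \<longrightarrow> sub_le C (kernel_rel C f) U \<longrightarrow> sub_le C T U \<longrightarrow>
      sub_le C (inverse_image C f S) U)" (is "?L \<longleftrightarrow> ?R")
  proof
    assume L: ?L
    show ?R
    proof (intro allI impI)
      fix U assume "internal_order C sy X U" "sub_le C (kernel_rel C f) U" and T: "sub_le C T U"
      then obtain W where W: "internal_order C sy Y W" "inverse_image C f W = U"
        using descend by blast
      then have "sub_le C S W" using L T by simp
      then show "sub_le C (inverse_image C f S) U"
        using inverse_image_mono[OF f internal_order_rel[OF S] internal_order_rel[OF W(1)]] W(2)
        by simp
    qed
  next
    assume R: ?R
    show ?L
    proof (intro allI impI)
      fix W assume W: "internal_order C sy Y W" and "sub_le C T (inverse_image C f W)"
      then have "sub_le C (inverse_image C f S) (inverse_image C f W)"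
        using R internal_order_inverse_image[OF f W] kernel_le_inverse_image[OF f W] by simp
      then show "sub_le C S W"
        by (rule reflect[OF internal_order_rel[OF S] internal_order_rel[OF W]])
    qed
  qed
  then show ?thesis
    unfolding cocartesian_iff_least[OF arr] is_join_order_cat[OF X]
    using T TS internal_order_kernel[OF f] internal_order_inverse_image[OF f S]
      kernel_le_inverse_image[OF f S] by simp
qed

section \<open>Split epimorphisms\<close>

text \<open>Since \<open>f \<cdot> s \<cdot> a = a\<close>, the pair \<open>(a, b)\<close> is in \<open>S\<close> exactly when \<open>(s \<cdot> a, s \<cdot> b)\<close> is in the
  inverse image of \<open>S\<close>.\<close>

lemma inverse_image_reflects_split:
  assumes f: "f \<in> hom C X Y" and s: "s \<in> hom C Y X" and fs: "f \<cdot> s = Ide C Y"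
    and S: "S \<in> relations C Y" and W: "W \<in> relations C Y"
    and le: "sub_le C (inverse_image C f S) (inverse_image C f W)"
  shows "sub_le C S W"
  unfolding sub_le_hom_rel[OF S W homD(5)[OF f]]
proof (intro allI subrelI)
  fix A a b assume ab: "(a, b) \<in> hom_rel C A Y S"
  have a: "a \<in> hom C A Y" and b: "b \<in> hom C A Y" using hom_rel_hom[OF ab] by auto
  have eq: "f \<cdot> (s \<cdot> c) = c" if "c \<in> hom C A Y" for c
    using hom_assoc[OF that s f] fs ide_cmp_hom[OF that] by simp
  have "(s \<cdot> a, s \<cdot> b) \<in> hom_rel C A X (inverse_image C f S)"
    using ab cmp_hom[OF a s] cmp_hom[OF b s] by (simp add: hom_rel_inverse_image[OF f S] eq a b)
  then have "(s \<cdot> a, s \<cdot> b) \<in> hom_rel C A X (inverse_image C f W)"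
    using le[unfolded sub_le_hom_rel[OF inverse_image_rel[OF f S] inverse_image_rel[OF f W]
          homD(4)[OF f]]] by blast
  then show "(a, b) \<in> hom_rel C A Y W" by (simp add: hom_rel_inverse_image[OF f W] eq a b)
qed

text \<open>The elements \<open>c\<close> and \<open>s \<cdot> f \<cdot> c\<close> have the same image under \<open>f\<close>, so they are related in both
  directions by \<open>V\<close>, and transitivity allows one to be replaced by the other.\<close>

lemma inverse_image_descend_split:
  assumes f: "f \<in> hom C X Y" and s: "s \<in> hom C Y X" and fs: "f \<cdot> s = Ide C Y"
    and V: "internal_order C sy X V" and le: "sub_le C (kernel_rel C f) V"
  shows "inverse_image C f (inverse_image C s V) = V"
proof -
  note V' = internal_order_rel[OF V]
  have W: "inverse_image C s V \<in> relations C Y" using inverse_image_rel[OF s V'] .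
  have ker: "(c, s \<cdot> (f \<cdot> c)) \<in> hom_rel C A X V \<and> (s \<cdot> (f \<cdot> c), c) \<in> hom_rel C A X V"
    if c: "c \<in> hom C A X" for A c
  proof -
    have "f \<cdot> (s \<cdot> (f \<cdot> c)) = f \<cdot> c"
      using hom_assoc[OF cmp_hom[OF c f] s f] fs ide_cmp_hom[OF cmp_hom[OF c f]] by simp
    then show ?thesis
      using c cmp_hom[OF cmp_hom[OF c f] s] le hom_rel_kernel[OF f]
      unfolding sub_le_hom_rel[OF kernel_rel_rel[OF f] V' homD(4)[OF f]] by fastforce
  qed
  have iff: "(a, b) \<in> hom_rel C A X (inverse_image C f (inverse_image C s V)) \<longleftrightarrow>
    a \<in> hom C A X \<and> b \<in> hom C A X \<and> (s \<cdot> (f \<cdot> a), s \<cdot> (f \<cdot> b)) \<in> hom_rel C A X V" for A a b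
    using cmp_hom[OF _ f]
    by (auto simp: hom_rel_inverse_image[OF f W] hom_rel_inverse_image[OF s V'])
  have "(a, b) \<in> hom_rel C A X (inverse_image C f (inverse_image C s V)) \<longleftrightarrow>
    (a, b) \<in> hom_rel C A X V" for A a b
    unfolding iff using ker internal_order_trans[OF V] hom_rel_hom by meson
  then show ?thesis
    by (intro rel_eqI[OF inverse_image_rel[OF f W] V' homD(4)[OF f]]) auto
qed

end

section \<open>Regular epimorphisms\<close>

context category
begin

lemma regular_epi_arr: "regular_epi C e \<Longrightarrow> e \<in> Arr C"
  by (auto simp: regular_epi_def is_coequalizer_def)

lemma regular_epi_iso:
  assumes e: "regular_epi C e" and i: "is_iso C i" and ei: "Cod C e = Dom C i"
  shows "regular_epi C (i \<cdot> e)"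
proof -
  obtain a b where co: "is_coequalizer C a b e" using e by (auto simp: regular_epi_def)
  obtain j where j: "j \<in> hom C (Cod C i) (Dom C i)" and ji: "j \<cdot> i = Ide C (Dom C i)"
    and ij: "i \<cdot> j = Ide C (Cod C i)"
    using i by (auto simp: is_iso_def)
  have eh: "e \<in> hom C (Dom C e) (Dom C i)"
    using homI[OF regular_epi_arr[OF e]] ei by simp
  have ih: "i \<in> hom C (Dom C i) (Cod C i)" using i by (auto simp: is_iso_def intro: homI)
  note ieh = cmp_hom[OF eh ih]
  obtain M where a: "a \<in> hom C M (Dom C e)" and b: "b \<in> hom C M (Dom C e)"
    using co by (auto simp: is_coequalizer_def)
  have "\<exists>!h. h \<in> hom C (Cod C i) Z \<and> h \<cdot> (i \<cdot> e) = g"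
    if g: "g \<in> hom C (Dom C e) Z" "g \<cdot> a = g \<cdot> b" for g Z
  proof -
    have ex: "\<exists>!h. h \<in> hom C (Dom C i) Z \<and> h \<cdot> e = g"
      using co that ei by (simp add: is_coequalizer_def)
    then obtain k where k: "k \<in> hom C (Dom C i) Z" "k \<cdot> e = g" by blast
    have kji: "(k \<cdot> j) \<cdot> i = k"
      using hom_assoc[OF ih j k(1)] ji cmp_ide_hom[OF k(1)] by simp
    show ?thesis
    proof (rule ex1I[of _ "k \<cdot> j"])
      show "k \<cdot> j \<in> hom C (Cod C i) Z \<and> (k \<cdot> j) \<cdot> (i \<cdot> e) = g"
        using cmp_hom[OF j k(1)] hom_assoc[OF eh ih cmp_hom[OF j k(1)]] kji k(2) by simp
      fix h assume h: "h \<in> hom C (Cod C i) Z \<and> h \<cdot> (i \<cdot> e) = g"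
      then have "h \<cdot> i = k"
        using ex k cmp_hom[OF ih, of h Z] hom_assoc[OF eh ih, of h Z] by auto
      then show "h = k \<cdot> j"
        using hom_assoc[OF j ih, of h Z] ij h cmp_ide_hom[of h "Cod C i" Z] by simp
    qed
  qed
  moreover have "(i \<cdot> e) \<cdot> a = (i \<cdot> e) \<cdot> b"
    using hom_assoc[OF a eh ih] hom_assoc[OF b eh ih] co by (simp add: is_coequalizer_def)
  ultimately have "is_coequalizer C a b (i \<cdot> e)"
    using a b homD(1,2,3)[OF ieh] unfolding is_coequalizer_def by auto
  then show ?thesis by (auto simp: regular_epi_def)
qed

lemma regular_epi_ide:
  assumes A: "A \<in> Obj C"
  shows "regular_epi C (Ide C A)"
proof -
  note i = ide_hom[OF A]
  have "is_coequalizer C (Ide C A) (Ide C A) (Ide C A)"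
    unfolding is_coequalizer_def homD(2,3)[OF i]
    using homD(1)[OF i] i cmp_ide_hom by metis
  then show ?thesis by (auto simp: regular_epi_def)
qed

text \<open>Regular epimorphisms are orthogonal to monomorphisms: the coequalized pair is also equalized
  by the given factorization of \<open>w \<cdot> e\<close>, because \<open>m\<close> can be cancelled.\<close>

lemma factors_descend:
  assumes e: "regular_epi C e" and w: "w \<in> hom C (Cod C e) B" and m: "monic C m" "Cod C m = B"
    and fac: "factors C (w \<cdot> e) m"
  shows "factors C w m"
proof -
  obtain a b where co: "is_coequalizer C a b e" using e by (auto simp: regular_epi_def)
  note eh = homI[OF regular_epi_arr[OF e]]
  have mh: "m \<in> hom C (Dom C m) B" using homI[OF monicD[OF m(1)]] m(2) by simp
  obtain M where a: "a \<in> hom C M (Dom C e)" and b: "b \<in> hom C M (Dom C e)"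
    and eab: "e \<cdot> a = e \<cdot> b"
    using co by (auto simp: is_coequalizer_def)
  obtain k where k: "k \<in> hom C (Dom C e) (Dom C m)" "m \<cdot> k = w \<cdot> e"
    using fac unfolding factors_def homD(2)[OF cmp_hom[OF eh w]] by blast
  have "m \<cdot> (k \<cdot> a) = m \<cdot> (k \<cdot> b)"
    using hom_assoc[OF a k(1) mh] hom_assoc[OF b k(1) mh] hom_assoc[OF a eh w]
      hom_assoc[OF b eh w] k(2) eab by simp
  then have "k \<cdot> a = k \<cdot> b"
    using monic_cancel[OF m(1) cmp_hom[OF a k(1)] cmp_hom[OF b k(1)]] by blast
  then obtain h where h: "h \<in> hom C (Cod C e) (Dom C m)" "h \<cdot> e = k"
    using co k(1) unfolding is_coequalizer_def by blast
  have "\<exists>!u. u \<in> hom C (Cod C e) B \<and> u \<cdot> e = w \<cdot> e"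
    using co cmp_hom[OF eh w] hom_assoc[OF a eh w] hom_assoc[OF b eh w] eab
    unfolding is_coequalizer_def by metis
  moreover have "(m \<cdot> h) \<cdot> e = w \<cdot> e" using hom_assoc[OF eh h(1) mh] h(2) k(2) by simp
  ultimately have "m \<cdot> h = w" using cmp_hom[OF h(1) mh] w by blast
  then show ?thesis using h(1) unfolding factors_def homD(2)[OF w] by blast
qed

end

context finitely_complete_category
begin

lemma hom_rel_descend:
  assumes R: "R \<in> relations C X" and a: "a \<in> hom C A X" and b: "b \<in> hom C A X"
    and e: "regular_epi C e" "e \<in> hom C A' A"
    and ab: "(a \<cdot> e, b \<cdot> e) \<in> hom_rel C A' X R"
  shows "(a, b) \<in> hom_rel C A X R"
proof -
  obtain m where m: "m \<in> R" using R subobject_nonempty unfolding relations_def by blast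
  have "factors C (pairing C a b \<cdot> e) m"
    using ab hom_rel_factors[OF R m cmp_hom[OF e(2) a] cmp_hom[OF e(2) b]]
      pairing_cmp[OF a b e(2)] by simp
  then have "factors C (pairing C a b) m"
    using factors_descend[OF e(1)] pairing_hom[OF a b] homD(3)[OF e(2)]
      subobject_monic[OF R[unfolded relations_def] m] by blast
  then show ?thesis using hom_rel_factors[OF R m a b] by simp
qed

end

context regular_category
begin

text \<open>Stability under pullback makes regular epimorphisms behave as covers: an element of the
  codomain lifts to the domain after refinement along a cover.\<close>

lemma regular_epi_lift:
  assumes e: "regular_epi C e" "e \<in> hom C P B" and k: "k \<in> hom C A B"
  obtains A' q p where "regular_epi C q" "q \<in> hom C A' A" "p \<in> hom C A' P" "e \<cdot> p = k \<cdot> q"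
proof -
  obtain p q where pb: "is_pullback C e k p q" using pullback_exists[OF e(2) k] by blast
  obtain A' where p: "p \<in> hom C A' P" and q: "q \<in> hom C A' A"
    using pb homD(2)[OF e(2)] homD(2)[OF k] by (auto simp: is_pullback_def)
  show ?thesis
    using that[OF regular_epi_stable[OF pb e(1)] q p] pb by (simp add: is_pullback_def)
qed

text \<open>In a regular category, images are described as in sets, up to a cover: a pair is in the direct
  image when, after restriction along some regular epimorphism \<open>q\<close>, it lifts to a pair in \<open>R\<close>.
  Orthogonality of the epimorphic part to monomorphisms makes the factorizations of
  \<open>square_map C f \<cdot> r\<close>, for \<open>r\<close> in \<open>R\<close>, form a single isomorphism class.\<close>

lemma direct_image:
  assumes f: "f \<in> hom C X Y" and R: "R \<in> relations C X"
  shows direct_image_rel: "direct_image C f R \<in> relations C Y"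
    and hom_rel_direct_imageE:
      "\<And>a b A. (a, b) \<in> hom_rel C A Y (direct_image C f R) \<Longrightarrow>
        \<exists>A' q x y. regular_epi C q \<and> q \<in> hom C A' A \<and> (x, y) \<in> hom_rel C A' X R \<and>
          f \<cdot> x = a \<cdot> q \<and> f \<cdot> y = b \<cdot> q"
    and hom_rel_direct_imageI:
      "\<And>a b A A' q x y. \<lbrakk>regular_epi C q; q \<in> hom C A' A; a \<in> hom C A Y; b \<in> hom C A Y;
         (x, y) \<in> hom_rel C A' X R; f \<cdot> x = a \<cdot> q; f \<cdot> y = b \<cdot> q\<rbrakk>
       \<Longrightarrow> (a, b) \<in> hom_rel C A Y (direct_image C f R)"
proof -
  note R' = R[unfolded relations_def] and sq = square_map_hom[OF f]
  let ?D = "direct_image C f R"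
  note X = homD(4)[OF f] and Y = homD(5)[OF f]
  have D: "\<exists>r e. r \<in> R \<and> regular_epi C e \<and> e \<in> hom C (Dom C r) (Dom C m) \<and>
      m \<cdot> e = square_map C f \<cdot> r \<and> m \<in> monos_into C (Prod C Y Y)" if mD: "m \<in> ?D" for m
  proof -
    obtain r e where m: "monic C m" and r: "r \<in> R" and e: "regular_epi C e" "Cod C e = Dom C m"
      and eq: "m \<cdot> e = square_map C f \<cdot> r"
      using mD unfolding direct_image_def by blast
    have rh: "square_map C f \<cdot> r \<in> hom C (Dom C r) (Prod C Y Y)"
      using cmp_hom[OF subobject_monic(4)[OF R' r] sq] .
    have eh: "e \<in> hom C (Dom C e) (Dom C m)"
      using homI[OF regular_epi_arr[OF e(1)]] e(2) by simp
    have "m \<cdot> e \<in> hom C (Dom C e) (Cod C m)" using cmp_hom[OF eh homI[OF monicD[OF m]]] .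
    then have "Dom C e = Dom C r" "Cod C m = Prod C Y Y"
      using rh eq homD(2,3) by metis+
    then have "e \<in> hom C (Dom C r) (Dom C m)" "m \<in> monos_into C (Prod C Y Y)"
      using eh m by (simp_all add: monos_into_def)
    then show ?thesis using r e(1) eq by blast
  qed
  have fac: "factors C m n" if m: "m \<in> ?D" and n: "n \<in> ?D" for m n
  proof -
    obtain r e where r: "r \<in> R" and e: "regular_epi C e" "e \<in> hom C (Dom C r) (Dom C m)"
      and eq: "m \<cdot> e = square_map C f \<cdot> r" and mm: "m \<in> monos_into C (Prod C Y Y)"
      using D[OF m] by blast
    obtain r' e' where r': "r' \<in> R" and e': "e' \<in> hom C (Dom C r') (Dom C n)"
      and eq': "n \<cdot> e' = square_map C f \<cdot> r'" and nn: "n \<in> monos_into C (Prod C Y Y)"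
      using D[OF n] by blast
    obtain i where i: "i \<in> hom C (Dom C r) (Dom C r')" "r' \<cdot> i = r"
      using subobject_factors[OF R' r r'] by (auto simp: factors_def)
    have "n \<cdot> (e' \<cdot> i) = m \<cdot> e"
      using hom_assoc[OF i(1) e' monos_intoD(4)[OF nn]] eq eq' i(2)
        hom_assoc[OF i(1) subobject_monic(4)[OF R' r'] sq] by simp
    then have "factors C (m \<cdot> e) n"
      using factorsI[OF cmp_hom[OF i(1) e'] monos_intoD(2)[OF nn]] by blast
    then show ?thesis
      using factors_descend[OF e(1)] monos_intoD[OF mm] monos_intoD[OF nn] homD(3)[OF e(2)]
      by metis
  qed
  obtain m where m: "m \<in> ?D"
  proof -
    obtain r where r: "r \<in> R" using R' subobject_nonempty by blast
    have "square_map C f \<cdot> r \<in> Arr C" using homD(1)[OF cmp_hom[OF subobject_monic(4)[OF R' r] sq]] .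
    then show ?thesis using factorization r that unfolding direct_image_def by blast
  qed
  then obtain r e where r: "r \<in> R" and e: "regular_epi C e" "e \<in> hom C (Dom C r) (Dom C m)"
    and eq: "m \<cdot> e = square_map C f \<cdot> r" and mm: "m \<in> monos_into C (Prod C Y Y)"
    using D by blast
  note mh = monos_intoD(4)[OF mm] and rh = subobject_monic(4)[OF R' r]
  show DY: "?D \<in> relations C Y"
    unfolding relations_def
  proof (rule subobjectI[OF mm])
    fix n
    show "n \<in> ?D \<longleftrightarrow> n \<in> monos_into C (Prod C Y Y) \<and> factors C m n \<and> factors C n m"
    proof
      assume "n \<in> ?D"
      then show "n \<in> monos_into C (Prod C Y Y) \<and> factors C m n \<and> factors C n m"
        using D fac m by blast
    next
      assume "n \<in> monos_into C (Prod C Y Y) \<and> factors C m n \<and> factors C n m"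
      then have "(m, n) \<in> mono_iso C (Prod C Y Y)" and nn: "n \<in> monos_into C (Prod C Y Y)"
        using mm mono_iso_iff by blast+
      then obtain i where i: "i \<in> hom C (Dom C m) (Dom C n)" "is_iso C i" "n \<cdot> i = m"
        by (auto simp: mono_iso_def)
      have "regular_epi C (i \<cdot> e)"
        using regular_epi_iso[OF e(1) i(2)] homD(3)[OF e(2)] homD(2)[OF i(1)] by simp
      moreover have "n \<cdot> (i \<cdot> e) = square_map C f \<cdot> r"
        using hom_assoc[OF e(2) i(1) monos_intoD(4)[OF nn]] i(3) eq by simp
      moreover have "Cod C (i \<cdot> e) = Dom C n" using homD(3)[OF cmp_hom[OF e(2) i(1)]] .
      ultimately show "n \<in> ?D"
        using r monos_intoD(1)[OF nn] unfolding direct_image_def by blast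
    qed
  qed
  show "\<exists>A' q x y. regular_epi C q \<and> q \<in> hom C A' A \<and> (x, y) \<in> hom_rel C A' X R \<and>
    f \<cdot> x = a \<cdot> q \<and> f \<cdot> y = b \<cdot> q" if ab: "(a, b) \<in> hom_rel C A Y ?D" for a b A
  proof -
    have a: "a \<in> hom C A Y" and b: "b \<in> hom C A Y" using hom_rel_hom[OF ab] by auto
    have "factors C (pairing C a b) m" using ab hom_rel_factors[OF DY m a b] by simp
    then obtain k where k: "k \<in> hom C A (Dom C m)" "m \<cdot> k = pairing C a b"
      unfolding factors_def homD(2)[OF pairing_hom[OF a b]] by blast
    obtain A' q p where q: "regular_epi C q" "q \<in> hom C A' A" and p: "p \<in> hom C A' (Dom C r)"
      and epkq: "e \<cdot> p = k \<cdot> q"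
      using regular_epi_lift[OF e k(1)] .
    obtain x y where x: "x \<in> hom C A' X" and y: "y \<in> hom C A' X" and xy: "r \<cdot> p = pairing C x y"
      using pairing_surj[OF cmp_hom[OF p rh] X X] .
    have "pairing C (f \<cdot> x) (f \<cdot> y) = square_map C f \<cdot> (r \<cdot> p)"
      using square_map_pairing[OF f x y] xy by simp
    also have "\<dots> = m \<cdot> (e \<cdot> p)"
      using hom_assoc[OF p rh sq] hom_assoc[OF p e(2) mh] eq by simp
    also have "\<dots> = pairing C (a \<cdot> q) (b \<cdot> q)"
      using hom_assoc[OF q(2) k(1) mh] k(2) epkq pairing_cmp[OF a b q(2)] by simp
    finally have "f \<cdot> x = a \<cdot> q \<and> f \<cdot> y = b \<cdot> q"
      using pairing_inject[OF cmp_hom[OF x f] cmp_hom[OF y f] cmp_hom[OF q(2) a]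
          cmp_hom[OF q(2) b]] by blast
    moreover have "factors C (pairing C x y) r"
      using factorsI[OF p subobject_monic(2)[OF R' r] xy] .
    then have "(x, y) \<in> hom_rel C A' X R" using hom_rel_factors[OF R r x y] by simp
    ultimately show ?thesis using q by blast
  qed
  show "(a, b) \<in> hom_rel C A Y ?D"
    if q: "regular_epi C q" "q \<in> hom C A' A" and a: "a \<in> hom C A Y" and b: "b \<in> hom C A Y"
      and xy: "(x, y) \<in> hom_rel C A' X R" and eqs: "f \<cdot> x = a \<cdot> q" "f \<cdot> y = b \<cdot> q"
    for a b A A' q x y
  proof -
    have x: "x \<in> hom C A' X" and y: "y \<in> hom C A' X" using hom_rel_hom[OF xy] by auto
    have "factors C (pairing C x y) r" using xy hom_rel_factors[OF R r x y] by simp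
    then obtain p where p: "p \<in> hom C A' (Dom C r)" "r \<cdot> p = pairing C x y"
      unfolding factors_def homD(2)[OF pairing_hom[OF x y]] by blast
    have "m \<cdot> (e \<cdot> p) = pairing C (a \<cdot> q) (b \<cdot> q)"
      using hom_assoc[OF p(1) rh sq] hom_assoc[OF p(1) e(2) mh] eq p(2)
        square_map_pairing[OF f x y] eqs by simp
    then have "factors C (pairing C (a \<cdot> q) (b \<cdot> q)) m"
      using factorsI[OF cmp_hom[OF p(1) e(2)] monos_intoD(2)[OF mm]] by blast
    then have "(a \<cdot> q, b \<cdot> q) \<in> hom_rel C A' Y ?D"
      using hom_rel_factors[OF DY m cmp_hom[OF q(2) a] cmp_hom[OF q(2) b]] by simp
    then show ?thesis by (rule hom_rel_descend[OF DY a b q])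
  qed
qed

text \<open>The two components of an element of \<open>S\<close> are lifted along \<open>f\<close> one after the other, which refines
  its domain twice; membership in \<open>W\<close> then descends along one cover at a time.\<close>

lemma inverse_image_reflects_regular:
  assumes f: "f \<in> hom C X Y" and epi: "regular_epi C f"
    and S: "S \<in> relations C Y" and W: "W \<in> relations C Y"
    and le: "sub_le C (inverse_image C f S) (inverse_image C f W)"
  shows "sub_le C S W"
  unfolding sub_le_hom_rel[OF S W homD(5)[OF f]]
proof (intro allI subrelI)
  fix A a b assume ab: "(a, b) \<in> hom_rel C A Y S"
  have a: "a \<in> hom C A Y" and b: "b \<in> hom C A Y" using hom_rel_hom[OF ab] by auto
  obtain A' q x where q: "regular_epi C q" "q \<in> hom C A' A" and x: "x \<in> hom C A' X"
    and fx: "f \<cdot> x = a \<cdot> q"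
    using regular_epi_lift[OF epi f a] .
  obtain A'' q' y where q': "regular_epi C q'" "q' \<in> hom C A'' A'" and y: "y \<in> hom C A'' X"
    and fy: "f \<cdot> y = (b \<cdot> q) \<cdot> q'"
    using regular_epi_lift[OF epi f cmp_hom[OF q(2) b]] .
  note aq = cmp_hom[OF q(2) a] and bq = cmp_hom[OF q(2) b]
  have fx': "f \<cdot> (x \<cdot> q') = (a \<cdot> q) \<cdot> q'" using hom_assoc[OF q'(2) x f] fx by simp
  have "((a \<cdot> q) \<cdot> q', (b \<cdot> q) \<cdot> q') \<in> hom_rel C A'' Y S"
    using hom_rel_precomp[OF S hom_rel_precomp[OF S ab q(2)] q'(2)] .
  then have "(x \<cdot> q', y) \<in> hom_rel C A'' X (inverse_image C f S)"
    unfolding hom_rel_inverse_image[OF f S] fx' fy using cmp_hom[OF q'(2) x] y by blast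
  then have "(x \<cdot> q', y) \<in> hom_rel C A'' X (inverse_image C f W)"
    using le[unfolded sub_le_hom_rel[OF inverse_image_rel[OF f S] inverse_image_rel[OF f W]
          homD(4)[OF f]]] by blast
  then have "((a \<cdot> q) \<cdot> q', (b \<cdot> q) \<cdot> q') \<in> hom_rel C A'' Y W"
    unfolding hom_rel_inverse_image[OF f W] fx' fy by blast
  then show "(a, b) \<in> hom_rel C A Y W"
    by (intro hom_rel_descend[OF W a b q] hom_rel_descend[OF W aq bq q'])
qed

lemma kernel_le_hom_rel:
  assumes f: "f \<in> hom C X Y" and V: "V \<in> relations C X" and le: "sub_le C (kernel_rel C f) V"
    and "a \<in> hom C A X" "b \<in> hom C A X" "f \<cdot> a = f \<cdot> b"
  shows "(a, b) \<in> hom_rel C A X V"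
  using le assms(4-) hom_rel_kernel[OF f]
  unfolding sub_le_hom_rel[OF kernel_rel_rel[OF f] V homD(4)[OF f]] by blast

text \<open>Reflexivity uses that \<open>f\<close> is a cover. For transitivity, \<open>b\<close> is lifted once with \<open>a\<close> and once
  with \<open>c\<close>; the kernel relation, being contained in \<open>V\<close>, links the two lifts.\<close>

lemma internal_order_direct_image:
  assumes f: "f \<in> hom C X Y" and epi: "regular_epi C f"
    and V: "internal_order C sy X V" and le: "sub_le C (kernel_rel C f) V"
  shows "internal_order C sy Y (direct_image C f V)"
proof (rule internal_orderI)
  note V' = internal_order_rel[OF V]
  show DY: "direct_image C f V \<in> relations C Y" using direct_image_rel[OF f V'] .
  show "(a, a) \<in> hom_rel C A Y (direct_image C f V)" if a: "a \<in> hom C A Y" for A a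
  proof -
    obtain A' q x where "regular_epi C q" "q \<in> hom C A' A" "x \<in> hom C A' X" "f \<cdot> x = a \<cdot> q"
      using regular_epi_lift[OF epi f a] .
    then show ?thesis
      using hom_rel_direct_imageI[OF f V' _ _ a a] internal_order_refl[OF V] by blast
  qed
  show "(b, a) \<in> hom_rel C A Y (direct_image C f V)"
    if sy and ab: "(a, b) \<in> hom_rel C A Y (direct_image C f V)" for A a b
    using hom_rel_direct_imageE[OF f V' ab] internal_order_sym[OF V that(1)]
      hom_rel_hom[OF ab] hom_rel_direct_imageI[OF f V'] by blast
  show "(a, c) \<in> hom_rel C A Y (direct_image C f V)"
    if ab: "(a, b) \<in> hom_rel C A Y (direct_image C f V)"
      and bc: "(b, c) \<in> hom_rel C A Y (direct_image C f V)" for A a b c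
  proof -
    have a: "a \<in> hom C A Y" and b: "b \<in> hom C A Y" and c: "c \<in> hom C A Y"
      using hom_rel_hom[OF ab] hom_rel_hom[OF bc] by auto
    obtain A' q x y where q: "regular_epi C q" "q \<in> hom C A' A"
      and xy: "(x, y) \<in> hom_rel C A' X V" and fxy: "f \<cdot> x = a \<cdot> q" "f \<cdot> y = b \<cdot> q"
      using hom_rel_direct_imageE[OF f V' ab] by blast
    have x: "x \<in> hom C A' X" and y: "y \<in> hom C A' X" using hom_rel_hom[OF xy] by auto
    obtain A'' q' y' z where q': "regular_epi C q'" "q' \<in> hom C A'' A'"
      and yz: "(y', z) \<in> hom_rel C A'' X V" and fyz: "f \<cdot> y' = (b \<cdot> q) \<cdot> q'" "f \<cdot> z = (c \<cdot> q) \<cdot> q'"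
      using hom_rel_direct_imageE[OF f V' hom_rel_precomp[OF DY bc q(2)]] by blast
    have y': "y' \<in> hom C A'' X" using hom_rel_hom[OF yz] by auto
    \<comment> \<open>Over \<open>A''\<close>, both \<open>y \<cdot> q'\<close> and \<open>y'\<close> lift \<open>b\<close>.\<close>
    have "f \<cdot> (y \<cdot> q') = f \<cdot> y'" using hom_assoc[OF q'(2) y f] fxy fyz by simp
    then have "(y \<cdot> q', y') \<in> hom_rel C A'' X V"
      using kernel_le_hom_rel[OF f V' le cmp_hom[OF q'(2) y] y'] by blast
    then have xz: "(x \<cdot> q', z) \<in> hom_rel C A'' X V"
      using internal_order_trans[OF V] hom_rel_precomp[OF V' xy q'(2)] yz by blast
    have "f \<cdot> (x \<cdot> q') = (a \<cdot> q) \<cdot> q'" using hom_assoc[OF q'(2) x f] fxy by simp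
    then have "(a \<cdot> q, c \<cdot> q) \<in> hom_rel C A' Y (direct_image C f V)"
      using hom_rel_direct_imageI[OF f V' q' cmp_hom[OF q(2) a] cmp_hom[OF q(2) c] xz] fyz by blast
    then show ?thesis by (rule hom_rel_descend[OF DY a c q])
  qed
qed

text \<open>If \<open>(f \<cdot> a, f \<cdot> b)\<close> lifts over a cover to a pair \<open>(x, y)\<close> in \<open>V\<close>, then \<open>a\<close> and \<open>x\<close> as well as
  \<open>y\<close> and \<open>b\<close> are related over the cover by the kernel relation, hence by \<open>V\<close>.\<close>

lemma inverse_direct_image:
  assumes f: "f \<in> hom C X Y"
    and V: "internal_order C sy X V" and le: "sub_le C (kernel_rel C f) V"
  shows "inverse_image C f (direct_image C f V) = V"
proof -
  note V' = internal_order_rel[OF V]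
  note DY = direct_image_rel[OF f V']
  have "(a, b) \<in> hom_rel C A X (inverse_image C f (direct_image C f V)) \<longleftrightarrow>
    (a, b) \<in> hom_rel C A X V" for A a b
  proof
    assume ab: "(a, b) \<in> hom_rel C A X (inverse_image C f (direct_image C f V))"
    have a: "a \<in> hom C A X" and b: "b \<in> hom C A X" using hom_rel_hom[OF ab] by auto
    have "(f \<cdot> a, f \<cdot> b) \<in> hom_rel C A Y (direct_image C f V)"
      using ab unfolding hom_rel_inverse_image[OF f DY] by blast
    then obtain A' q x y where q: "regular_epi C q" "q \<in> hom C A' A"
      and xy: "(x, y) \<in> hom_rel C A' X V" and fxy: "f \<cdot> x = (f \<cdot> a) \<cdot> q" "f \<cdot> y = (f \<cdot> b) \<cdot> q"
      using hom_rel_direct_imageE[OF f V'] by blast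
    have x: "x \<in> hom C A' X" and y: "y \<in> hom C A' X" using hom_rel_hom[OF xy] by auto
    have "(a \<cdot> q, x) \<in> hom_rel C A' X V" "(y, b \<cdot> q) \<in> hom_rel C A' X V"
      using kernel_le_hom_rel[OF f V' le cmp_hom[OF q(2) a] x]
        kernel_le_hom_rel[OF f V' le y cmp_hom[OF q(2) b]]
        hom_assoc[OF q(2) a f] hom_assoc[OF q(2) b f] fxy by simp_all
    then have "(a \<cdot> q, b \<cdot> q) \<in> hom_rel C A' X V"
      using xy internal_order_trans[OF V] by blast
    then show "(a, b) \<in> hom_rel C A X V" by (rule hom_rel_descend[OF V' a b q])
  next
    assume ab: "(a, b) \<in> hom_rel C A X V"
    have a: "a \<in> hom C A X" and b: "b \<in> hom C A X" using hom_rel_hom[OF ab] by auto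
    note A = homD(4)[OF a]
    have "(f \<cdot> a, f \<cdot> b) \<in> hom_rel C A Y (direct_image C f V)"
      using hom_rel_direct_imageI[OF f V' regular_epi_ide[OF A] ide_hom[OF A] cmp_hom[OF a f]
          cmp_hom[OF b f] ab] cmp_ide_hom[OF cmp_hom[OF a f]] cmp_ide_hom[OF cmp_hom[OF b f]]
      by simp
    then show "(a, b) \<in> hom_rel C A X (inverse_image C f (direct_image C f V))"
      unfolding hom_rel_inverse_image[OF f DY] using a b by blast
  qed
  then show ?thesis
    by (intro rel_eqI[OF inverse_image_rel[OF f DY] V' homD(4)[OF f]]) auto
qed

end

section \<open>Characterization of cocartesian maps\<close>

lemma (in finitely_complete_category) cocartesian_iff_join_split:
  assumes f: "f \<in> hom C X Y" and s: "s \<in> hom C Y X" and fs: "f \<cdot> s = Ide C Y"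
    and arr: "((X, T), f, (Y, S)) \<in> Arr (order_cat C sy)"
  shows "cocartesian (order_cat C sy) C ground ((X, T), f, (Y, S)) \<longleftrightarrow>
    is_join (fibre_order C (order_cat C sy) X) (inverse_image C f S) (kernel_rel C f) T"
proof (rule cocartesian_iff_join[OF arr])
  show "sub_le C S W" if "S \<in> relations C Y" "W \<in> relations C Y"
    "sub_le C (inverse_image C f S) (inverse_image C f W)" for S W
    using inverse_image_reflects_split[OF f s fs that] .
  show "\<exists>W. internal_order C sy Y W \<and> inverse_image C f W = V"
    if "internal_order C sy X V" "sub_le C (kernel_rel C f) V" for V
    using internal_order_inverse_image[OF s that(1)] inverse_image_descend_split[OF f s fs that]
    by blast
qed

context regular_category
begin

lemma cocartesian_iff_join_regular:
  assumes f: "f \<in> hom C X Y" and epi: "regular_epi C f"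
    and arr: "((X, T), f, (Y, S)) \<in> Arr (order_cat C sy)"
  shows "cocartesian (order_cat C sy) C ground ((X, T), f, (Y, S)) \<longleftrightarrow>
    is_join (fibre_order C (order_cat C sy) X) (inverse_image C f S) (kernel_rel C f) T"
proof (rule cocartesian_iff_join[OF arr])
  show "sub_le C S W" if "S \<in> relations C Y" "W \<in> relations C Y"
    "sub_le C (inverse_image C f S) (inverse_image C f W)" for S W
    using inverse_image_reflects_regular[OF f epi that] .
  show "\<exists>W. internal_order C sy Y W \<and> inverse_image C f W = V"
    if "internal_order C sy X V" "sub_le C (kernel_rel C f) V" for V
    using internal_order_direct_image[OF f epi that] inverse_direct_image[OF f that] by blast
qed

text \<open>The inverse image of the direct image of \<open>V\<close> is the join \<open>V\<close> itself, so the arrow to the direct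
  image is cocartesian by the preceding criterion. Any other cocartesian image is least for the same
  property, hence equal to it.\<close>

lemma cocartesian_image_iff:
  assumes f: "f \<in> hom C X Y" and epi: "regular_epi C f"
    and join: "is_join (fibre_order C (order_cat C sy) X) V (kernel_rel C f) T"
  shows "cocartesian_image (order_cat C sy) C ground f (X, T) Z \<longleftrightarrow> Z = (Y, direct_image C f V)"
proof -
  let ?K = "order_cat C sy" and ?fV = "direct_image C f V"
  have T: "internal_order C sy X T" and V: "internal_order C sy X V"
    and ker: "sub_le C (kernel_rel C f) V" and TV: "sub_le C T V"
    using join unfolding is_join_order_cat[OF homD(4)[OF f]] by auto
  note fV = internal_order_direct_image[OF f epi V ker] and inv = inverse_direct_image[OF f V ker]
  have arr: "((X, T), f, (Y, ?fV)) \<in> Arr ?K"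
    unfolding Arr_order_cat using T fV f inv TV by simp
  have coc: "cocartesian ?K C ground ((X, T), f, (Y, ?fV))"
    unfolding cocartesian_iff_join_regular[OF f epi arr] inv using join .
  have image: "cocartesian_image ?K C ground f (X, T) Z \<longleftrightarrow>
      ((X, T), f, Z) \<in> Arr ?K \<and> cocartesian ?K C ground ((X, T), f, Z)" for Z
    by (cases Z) (auto simp: cocartesian_image_def hom_def order_cat_simps ground_def)
  show ?thesis
  proof
    assume Z: "cocartesian_image ?K C ground f (X, T) Z"
    obtain Y' S where Y'S: "Z = (Y', S)" by (cases Z)
    have "f \<in> hom C X Y'" using Z unfolding image Y'S Arr_order_cat by blast
    then have "Y' = Y" using homD(3)[OF f] homD(3) by blast
    then have arr': "((X, T), f, (Y, S)) \<in> Arr ?K" and "cocartesian ?K C ground ((X, T), f, (Y, S))"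
      using Z unfolding image Y'S by auto
    moreover have S: "internal_order C sy Y S" "sub_le C T (inverse_image C f S)"
      using arr' unfolding Arr_order_cat by auto
    ultimately have "sub_le C S ?fV" "sub_le C ?fV S"
      using coc fV TV inv unfolding cocartesian_iff_least[OF arr] cocartesian_iff_least[OF arr']
      by auto
    then have "S = ?fV"
      using internal_order_rel[OF S(1)] internal_order_rel[OF fV] sub_le_antisym
      unfolding relations_def by blast
    then show "Z = (Y, ?fV)" using Y'S \<open>Y' = Y\<close> by simp
  next
    assume "Z = (Y, ?fV)"
    then show "cocartesian_image ?K C ground f (X, T) Z" using image arr coc by simp
  qed
qed

end

theorem proposition2p3:
  fixes E :: "('o, 'a) cat"
    and K :: "(('o, 'a) rel_obj, ('o, 'a) rel_arr) cat"
  assumes "finitely_complete_category E"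
    and "K = PrO E \<or> K = Equ E"
  shows
    "(\<forall>X Y f s T S.
        f \<in> hom E X Y \<and> s \<in> hom E Y X \<and> f \<cdot>\<^bsub>E\<^esub> s = Ide E Y \<and>
        ((X, T), f, (Y, S)) \<in> Arr K \<longrightarrow>
        (cocartesian K E ground ((X, T), f, (Y, S)) \<longleftrightarrow>
         is_join (fibre_order E K X) (inverse_image E f S) (kernel_rel E f) T)) \<and>
     (regular_category E \<longrightarrow>
        (\<forall>X Y f T. f \<in> hom E X Y \<and> regular_epi E f \<and> (X, T) \<in> Obj K \<longrightarrow>
           (\<forall>S. ((X, T), f, (Y, S)) \<in> Arr K \<longrightarrow>
              (cocartesian K E ground ((X, T), f, (Y, S)) \<longleftrightarrow>
               is_join (fibre_order E K X) (inverse_image E f S) (kernel_rel E f) T)) \<and>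
           (\<forall>V. is_join (fibre_order E K X) V (kernel_rel E f) T \<longrightarrow>
              (\<forall>Z. cocartesian_image K E ground f (X, T) Z \<longleftrightarrow>
                   Z = (Y, direct_image E f V)))))"
proof -
  interpret finitely_complete_category E by fact
  obtain sy where K: "K = order_cat E sy"
    using assms(2) by (metis order_cat_def)
  show ?thesis
    unfolding K
  proof (intro conjI impI allI; (elim conjE)?)
    fix X Y f s T S
    assume "f \<in> hom E X Y" "s \<in> hom E Y X" "f \<cdot>\<^bsub>E\<^esub> s = Ide E Y"
      "((X, T), f, (Y, S)) \<in> Arr (order_cat E sy)"
    then show "cocartesian (order_cat E sy) E ground ((X, T), f, (Y, S)) \<longleftrightarrow>
      is_join (fibre_order E (order_cat E sy) X) (inverse_image E f S) (kernel_rel E f) T"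
      by (rule cocartesian_iff_join_split)
  next
    fix X Y f T S
    assume "regular_category E"
    then interpret regular_category E .
    assume "f \<in> hom E X Y" "regular_epi E f" "((X, T), f, (Y, S)) \<in> Arr (order_cat E sy)"
    then show "cocartesian (order_cat E sy) E ground ((X, T), f, (Y, S)) \<longleftrightarrow>
      is_join (fibre_order E (order_cat E sy) X) (inverse_image E f S) (kernel_rel E f) T"
      by (rule cocartesian_iff_join_regular)
  next
    fix X Y f T V Z
    assume "regular_category E"
    then interpret regular_category E .
    assume "f \<in> hom E X Y" "regular_epi E f"
      "is_join (fibre_order E (order_cat E sy) X) V (kernel_rel E f) T"
    then show "cocartesian_image (order_cat E sy) E ground f (X, T) Z \<longleftrightarrow>
      Z = (Y, direct_image E f V)"
      by (rule cocartesian_image_iff)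
  qed
qed

end
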